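(* Let $\tau>0$, $\eta>0$, $\theta_Y\in[0,\pi]$, and let $\gamma(\mathbf n)=\sum_{i=1}^L\gamma_i(\mathbf n)=\sum_{i=1}^L\sqrt{\mathbf n^TG_i\mathbf n}$ with $G_i\in\mathbb R^{3\times3}$ symmetric positive definite, $i=1,\dots,L$. Let $S^0$ be an initial polygonal surface and, for $m\ge0$, let $(\mathbf X^{m+1},\mu^{m+1})\in\mathbb X^m\times\mathbb M^m$ be the numerical solution of the scheme $$\Bigl(\tfrac{\mathbf X^{m+1}-\mathbf X^m}{\tau},\mathbf n^m\psi^h\Bigr)^h_{S^m}+\bigl(\nabla_s\mu^{m+1},\nabla_s\psi^h\bigr)_{S^m}=0\qquad\forall\,\psi^h\in\mathbb M^m,$$ $$\bigl(\mu^{m+1}\mathbf n^m,\boldsymbol g^h\bigr)^h_{S^m}-\sum_{i=1}^L\Bigl(\gamma_i(\mathbf n^m),\bigl(\nabla_s^{\widetilde G_i}\mathbf X^{m+1},\nabla_s^{\widetilde G_i}\boldsymbol g^h\bigr)_{\widetilde G_i}\Bigr)_{S^m}+\cos\theta_Y\bigl(\mathbf n_\Gamma^{m+\frac12},\boldsymbol g^h\bigr)_{\Gamma^m}-\frac1{\eta\tau}\bigl((\mathbf X_\Gamma^{m+1}-\mathbf X_\Gamma^m)\cdot\mathbf n_\Gamma^m,\boldsymbol g^h\cdot\mathbf n_\Gamma^m\bigr)_{\Gamma^m}=0\qquad\forall\,\boldsymbol g^h\in\mathbb X^m,$$ with $S^{m+1}:=\mathbf X^{m+1}(S^m)$. Put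 $$W_\gamma^m:=\int_{S^m}\gamma(\mathbf n^m)\,\mathrm dA-\cos\theta_Y|S_1^m|=\sum_{j=1}^N\gamma(\mathbf n_j^m)|\sigma_j^m|-\cos\theta_Y|S_1^m|.$$ Then the total energy decreases in time: $$W_\gamma^{m+1}\le W_\gamma^m\le W_\gamma^0=\sum_{i=1}^L\sum_{j=1}^N\gamma_i(\mathbf n_j^0)|\sigma_j^0|-\cos\theta_Y|S_1^0|,\qquad\forall\,m\ge0.$$ Moreover, for all $m\ge0$, $$\sum_{l=1}^{m+1}\bigl\|\nabla_s\mu^l\bigr\|^2_{S^{l-1}}+\frac1\eta\sum_{l=1}^{m+1}\Bigl\|\Bigl(\frac{\mathbf X_\Gamma^l-\mathbf X_\Gamma^{l-1}}{\tau}\Bigr)\cdot\mathbf n_\Gamma^{l-1}\Bigr\|^2_{\Gamma^{l-1}}\le\frac{W_\gamma^0-W_\gamma^{m+1}}{\tau},$$ where $\|\cdot\|_{S^l}$ and $\|\cdot\|_{\Gamma^l}$ are the $L^2$-norms over $S^l$ and $\Gamma^l$.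
   Context: Mesh. For each $m\ge0$, $S^m=\bigcup_{j=1}^N\overline{\sigma_j^m}\subset\mathbb R^3$ is a polygonal surface consisting of $N$ mutually disjoint non-degenerate (open) triangles $\sigma_j^m$ with vertices $\mathbf q_{j_1}^m,\mathbf q_{j_2}^m,\mathbf q_{j_3}^m$ (ordered anticlockwise on the outer side of $S^m$), forming a triangulation; $|\sigma_j^m|$ is the area of $\sigma_j^m$. Its boundary $\Gamma^m=\bigcup_{j=1}^{N_\Gamma}\overline{l_j^m}$ is a simple closed, positively oriented polygonal curve in the plane $\{x_3=0\}$ with segments $l_j^m=[\mathbf p_{j_1}^m,\mathbf p_{j_2}^m]$. The triangles of $S^{m+1}=\mathbf X^{m+1}(S^m)$ are the images $\mathbf X^{m+1}(\sigma_j^m)$, and $\Gamma^{m+1}=\mathbf X^{m+1}(\Gamma^m)$; the surfaces at all time levels are assumed to be of this type. $|S_1^m|$ is the area of the plane region enclosed by $\Gamma^m$. $\mathbf e_z=(0,0,1)^T$. Normals. $\mathbf n^m$ is piecewise constant, equal on $\sigma_j^m$ to $\mathbf n_j^m=\frac{(\mathbf q_{j_2}^m-\mathbf q_{j_1}^m)\times(\mathbf q_{j_3}^m-\mathbf q_{j_1}^m)}{\|(\mathbf q_{j_2}^m-\mathbf q_{j_1}^m)\times(\mathbf q_{j_3}^m-\mathbf q_{j_1}^m)\|}$; $\mathbf n_\Gamma^m$ is equal on $l_j^m$ to $\frac{(\mathbf p_{j_2}^m-\mathbf p_{j_1}^m)\times\mathbf e_z}{\|(\mathbf p_{j_2}^m-\mathbf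 p_{j_1}^m)\times\mathbf e_z\|}$. Spaces. $\mathbb M^m$ is the space of continuous real functions on $S^m$ that are affine on each $\sigma_j^m$; $\mathbb M_0^m\subset\mathbb M^m$ consists of those vanishing on $\Gamma^m$; $\mathbb X^m=\mathbb M^m\times\mathbb M^m\times\mathbb M^m_0$. In the scheme on $S^m$, $\mathbf X^m\in\mathbb X^m$ is the identity function on $S^m$; $\mathbf X_\Gamma^m,\mathbf X_\Gamma^{m+1}$ are the restrictions of $\mathbf X^m,\mathbf X^{m+1}$ to $\Gamma^m$. Products. $(\cdot,\cdot)_{S^m}$ and $(\cdot,\cdot)_{\Gamma^m}$ are the $L^2$ inner products over $S^m$ (area) and $\Gamma^m$ (arc length), using dot products for vectors; $\nabla_s$ is the (piecewise) surface gradient on $S^m$, $\nabla_sf=(\mathbb I-\mathbf n^m\otimes\mathbf n^m)\nabla f$ (in $\|\nabla_s\mu^l\|_{S^{l-1}}$ it is taken on $S^{l-1}$). The mass-lumped product is $(f,g)^h_{S^m}=\frac13\sum_{j=1}^N\sum_{k=1}^3|\sigma_j^m|\,f((\mathbf q_{j_k}^m)^-)\cdot g((\mathbf q_{j_k}^m)^-)$, where $f((\mathbf q_{j_k}^m)^-)$ is the limit of $f$ at $\mathbf q_{j_k}^m$ from within $\sigma_j^m$. Further, $\mathbf n_\Gamma^{m+\frac12}=\frac12(\partial_s\mathbf X_\Gamma^m+\partial_s\mathbf X_\Gamma^{m+1})\times\mathbf e_z$, with $s$ the arc length parameter of $\Gamma^m$. Anisotropic gradient. For a symmetric positive definite $G$,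 put $\widetilde G=(\det G)^{\frac12}G^{-1}$. At a point of $S^m$ (in the interior of a triangle) let $\{\mathbf t_1,\mathbf t_2\}$ be a basis of the tangent plane with $\mathbf t_i\cdot(\widetilde G\,\mathbf t_j)=\delta_{ij}$, and let $\partial_{\mathbf t_i}$ denote the directional derivative, $\partial_{\mathbf t_i}f=\mathbf t_i\cdot\nabla_sf$ (componentwise for vectors). The pointwise product of anisotropic surface gradients of vector-valued $\mathbf u,\mathbf w$ is $$\bigl(\nabla_s^{\widetilde G}\mathbf u,\nabla_s^{\widetilde G}\mathbf w\bigr)_{\widetilde G}=\sum_{i=1}^2\partial_{\mathbf t_i}\mathbf u\cdot(\widetilde G\,\partial_{\mathbf t_i}\mathbf w).$$ $\widetilde G_i$ denotes this matrix for $G=G_i$. *)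

theory Defs
  imports "HOL-Complex_Analysis.Complex_Analysis"
begin

unbundle cross3_syntax
no_notation fps_nth (infixl \<open>$\<close> 75)

section \<open>Polygonal surfaces\<close>

text \<open>
  A mesh carries the data indexed as on paper: \<open>tri_vertex M j k\<close> is the \<open>k\<close>-th vertex
  (\<open>k = 1, 2, 3\<close>) of the triangle with number \<open>j \<in> {1..ntri M}\<close>, and \<open>seg_vertex M j 1\<close>,
  \<open>seg_vertex M j 2\<close> are the initial and the final point of the boundary segment with number
  \<open>j \<in> {1..nseg M}\<close>. Values at other indices are irrelevant.
\<close>

record mesh =
  ntri :: nat
  tri_vertex :: "nat \<Rightarrow> nat \<Rightarrow> real^3"
  nseg :: nat
  seg_vertex :: "nat \<Rightarrow> nat \<Rightarrow> real^3"

definition tri_vertices :: "mesh \<Rightarrow> nat \<Rightarrow> (real^3) set" where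
  "tri_vertices M j = tri_vertex M j ` {1, 2, 3}"

definition tri :: "mesh \<Rightarrow> nat \<Rightarrow> (real^3) set" where
  "tri M j = rel_interior (convex hull tri_vertices M j)"

definition surface :: "mesh \<Rightarrow> (real^3) set" where
  "surface M = (\<Union>j\<in>{1..ntri M}. closure (tri M j))"

definition seg :: "mesh \<Rightarrow> nat \<Rightarrow> (real^3) set" where
  "seg M j = open_segment (seg_vertex M j 1) (seg_vertex M j 2)"

definition boundary :: "mesh \<Rightarrow> (real^3) set" where
  "boundary M = (\<Union>j\<in>{1..nseg M}. closed_segment (seg_vertex M j 1) (seg_vertex M j 2))"

definition tri_cross :: "mesh \<Rightarrow> nat \<Rightarrow> real^3" where
  "tri_cross M j =
     (tri_vertex M j 2 - tri_vertex M j 1) \<times> (tri_vertex M j 3 - tri_vertex M j 1)"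

definition tri_area :: "mesh \<Rightarrow> nat \<Rightarrow> real" where
  "tri_area M j = norm (tri_cross M j) / 2"

definition seg_length :: "mesh \<Rightarrow> nat \<Rightarrow> real" where
  "seg_length M j = norm (seg_vertex M j 2 - seg_vertex M j 1)"

definition tri_edge :: "mesh \<Rightarrow> nat \<times> nat \<Rightarrow> (real^3) \<times> (real^3)" where
  "tri_edge M = (\<lambda>(j, k). (tri_vertex M j k, tri_vertex M j (k mod 3 + 1)))"

definition tri_edges :: "mesh \<Rightarrow> ((real^3) \<times> (real^3)) set" where
  "tri_edges M = tri_edge M ` Sigma {1..ntri M} (\<lambda>_. {1, 2, 3})"

text \<open>The plane \<open>{x\<^sub>3 = 0}\<close>, oriented by \<open>e\<^sub>z\<close>, is identified with the complex plane, so that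
  the library's simple paths and winding numbers apply to the boundary curve.\<close>

definition plane_proj :: "real^3 \<Rightarrow> complex" where
  "plane_proj x = Complex (x $ 1) (x $ 2)"

fun polygonal_path :: "complex list \<Rightarrow> real \<Rightarrow> complex" where
  "polygonal_path [] = linepath 0 0"
| "polygonal_path [a] = linepath a a"
| "polygonal_path [a, b] = linepath a b"
| "polygonal_path (a # b # c # as) = linepath a b +++ polygonal_path (b # c # as)"

definition boundary_path :: "mesh \<Rightarrow> real \<Rightarrow> complex" where
  "boundary_path M = polygonal_path
     (map (\<lambda>j. plane_proj (seg_vertex M j 1)) [1..<nseg M + 1] @ [plane_proj (seg_vertex M 1 1)])"

definition enclosed_area :: "mesh \<Rightarrow> real" where
  "enclosed_area M = measure lebesgue (inside (plane_proj ` boundary M))"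

text \<open>
  The triangulation conditions say, in this order: distinct closed triangles meet in a common
  face (possibly empty); adjacent triangles induce opposite directions on their common edge, and
  no edge lies in more than two triangles (no directed edge occurs twice); the directed edges
  without an opposite partner are exactly the segments of the boundary curve. The last two
  conditions express that the vertices are ordered anticlockwise with respect to one fixed side
  of the surface. As the film lies above the substrate region enclosed by the curve, the outer
  side is the one from which the positively oriented boundary curve has its induced
  orientation. The boundary segments are numbered consecutively along the curve.
\<close>

definition triangulation :: "mesh \<Rightarrow> bool" where
  "triangulation M \<longleftrightarrow>
     (\<forall>i\<in>{1..ntri M}. \<forall>j\<in>{1..ntri M}. i \<noteq> j \<longrightarrow>
        (convex hull tri_vertices M i) \<inter> (convex hull tri_vertices M j)
          = convex hull (tri_vertices M i \<inter> tri_vertices M j)) \<and>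
     inj_on (tri_edge M) (Sigma {1..ntri M} (\<lambda>_. {1, 2, 3})) \<and>
     {(a, b) \<in> tri_edges M. (b, a) \<notin> tri_edges M}
       = (\<lambda>j. (seg_vertex M j 1, seg_vertex M j 2)) ` {1..nseg M}"

definition polygonal_surface :: "mesh \<Rightarrow> bool" where
  "polygonal_surface M \<longleftrightarrow>
     (\<forall>j\<in>{1..ntri M}. \<not> collinear (tri_vertices M j)) \<and>
     (\<forall>i\<in>{1..ntri M}. \<forall>j\<in>{1..ntri M}. i \<noteq> j \<longrightarrow> tri M i \<inter> tri M j = {}) \<and>
     triangulation M \<and>
     (\<forall>x\<in>boundary M. x $ 3 = 0) \<and>
     (\<forall>j\<in>{1..nseg M}. seg_vertex M j 2 = seg_vertex M (j mod nseg M + 1) 1) \<and>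
     simple_path (boundary_path M) \<and>
     (\<forall>z\<in>inside (path_image (boundary_path M)). winding_number (boundary_path M) z = 1)"

definition image_mesh :: "(real^3 \<Rightarrow> real^3) \<Rightarrow> mesh \<Rightarrow> mesh" where
  "image_mesh X M = \<lparr>ntri = ntri M, tri_vertex = (\<lambda>j k. X (tri_vertex M j k)),
                     nseg = nseg M, seg_vertex = (\<lambda>j k. X (seg_vertex M j k))\<rparr>"


section \<open>Normals and finite element spaces\<close>

definition e_z :: "real^3" where
  "e_z = vector [0, 0, 1]"

definition tri_normal :: "mesh \<Rightarrow> nat \<Rightarrow> real^3" where
  "tri_normal M j = tri_cross M j /\<^sub>R norm (tri_cross M j)"

text \<open>Piecewise defined fields are functions of the point; they are only meaningful on the open
  triangles (open segments), where the number of the triangle (segment) is unique.\<close>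

definition tri_of :: "mesh \<Rightarrow> real^3 \<Rightarrow> nat" where
  "tri_of M x = (THE j. j \<in> {1..ntri M} \<and> x \<in> tri M j)"

definition seg_of :: "mesh \<Rightarrow> real^3 \<Rightarrow> nat" where
  "seg_of M x = (THE j. j \<in> {1..nseg M} \<and> x \<in> seg M j)"

definition surf_normal :: "mesh \<Rightarrow> real^3 \<Rightarrow> real^3" where
  "surf_normal M x = tri_normal M (tri_of M x)"

definition seg_dir :: "mesh \<Rightarrow> nat \<Rightarrow> real^3" where
  "seg_dir M j = seg_vertex M j 2 - seg_vertex M j 1"

definition bdry_normal :: "mesh \<Rightarrow> real^3 \<Rightarrow> real^3" where
  "bdry_normal M x =
     (let c = seg_dir M (seg_of M x) \<times> e_z in c /\<^sub>R norm c)"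

definition fe_space :: "mesh \<Rightarrow> (real^3 \<Rightarrow> real) set" where
  "fe_space M = {f. continuous_on (surface M) f \<and>
     (\<forall>j\<in>{1..ntri M}. \<exists>a b. \<forall>x\<in>tri M j. f x = a \<bullet> x + b)}"

definition fe_space0 :: "mesh \<Rightarrow> (real^3 \<Rightarrow> real) set" where
  "fe_space0 M = {f \<in> fe_space M. \<forall>x\<in>boundary M. f x = 0}"

definition fe_vec_space :: "mesh \<Rightarrow> (real^3 \<Rightarrow> real^3) set" where
  "fe_vec_space M = {u. (\<lambda>x. u x $ 1) \<in> fe_space M \<and> (\<lambda>x. u x $ 2) \<in> fe_space M \<and>
     (\<lambda>x. u x $ 3) \<in> fe_space0 M}"


text \<open>The new mesh is given by moving the vertices. Its triangles, its surface and its boundary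
  curve are the images of the old ones.\<close>

lemma closure_tri: "closure (tri M j) = convex hull tri_vertices M j"
  unfolding tri_def
  by (simp add: tri_vertices_def convex_closure_rel_interior finite_imp_compact
      compact_convex_hull compact_imp_closed)

lemma fe_vec_space_affine:
  assumes X: "X \<in> fe_vec_space M" and j: "j \<in> {1..ntri M}"
  shows "\<exists>A c. linear A \<and> (\<forall>x\<in>convex hull tri_vertices M j. X x = A x + c)"
proof -
  have comp: "\<exists>a b. \<forall>x\<in>convex hull tri_vertices M j. X x $ k = a \<bullet> x + b" for k :: 3
  proof -
    have f: "(\<lambda>x. X x $ k) \<in> fe_space M"
      using X exhaust_3[of k] by (auto simp: fe_vec_space_def fe_space0_def)
    then obtain a b where ab: "\<And>x. x \<in> tri M j \<Longrightarrow> X x $ k = a \<bullet> x + b"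
      using j unfolding fe_space_def by blast
    have cont: "continuous_on (closure (tri M j)) (\<lambda>x. X x $ k)"
      using f j unfolding fe_space_def surface_def
      by (auto elim!: continuous_on_subset)
    have "X x $ k - (a \<bullet> x + b) = 0" if "x \<in> closure (tri M j)" for x
      by (rule continuous_constant_on_closure[OF _ _ that])
         (auto intro!: continuous_intros cont simp: ab)
    then show ?thesis using closure_tri by (metis eq_iff_diff_eq_0)
  qed
  then obtain a b where ab: "\<And>k x. x\<in>convex hull tri_vertices M j \<Longrightarrow> X x $ k = a k \<bullet> x + b k"
    by metis
  have "linear (\<lambda>x. \<chi> k::3. a k \<bullet> x)"
    by (intro linearI) (auto simp: vec_eq_iff inner_add_right)
  moreover have "\<forall>x\<in>convex hull tri_vertices M j. X x = (\<chi> k. a k \<bullet> x) + (\<chi> k. b k)"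
    by (auto simp: vec_eq_iff ab)
  ultimately show ?thesis by blast
qed

lemma tri_image_mesh:
  assumes X: "X \<in> fe_vec_space M" and j: "j \<in> {1..ntri M}"
  shows "tri (image_mesh X M) j = X ` tri M j"
proof -
  obtain A c where lin: "linear A" and A: "\<And>x. x\<in>convex hull tri_vertices M j \<Longrightarrow> X x = A x + c"
    using fe_vec_space_affine[OF X j] by blast
  let ?V = "tri_vertices M j"
  have "tri_vertices (image_mesh X M) j = X ` ?V"
    by (simp add: tri_vertices_def image_mesh_def image_image)
  also have "\<dots> = (\<lambda>x. c + x) ` (A ` ?V)"
    unfolding image_image by (rule image_cong) (auto simp: A hull_inc add.commute)
  finally have "tri (image_mesh X M) j = rel_interior (convex hull ((+) c ` (A ` ?V)))"
    by (simp add: tri_def)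
  also have "\<dots> = (+) c ` (A ` rel_interior (convex hull ?V))"
    using lin by (simp add: convex_hull_translation rel_interior_translation convex_hull_linear_image
        rel_interior_convex_linear_image linear_linear)
  also have "\<dots> = X ` tri M j"
    unfolding image_image tri_def
    by (rule image_cong) (simp_all add: A add.commute subsetD[OF rel_interior_subset])
  finally show ?thesis .
qed

lemma surface_image_mesh:
  assumes X: "X \<in> fe_vec_space M"
  shows "surface (image_mesh X M) = X ` surface M"
proof -
  have "convex hull tri_vertices (image_mesh X M) j = X ` (convex hull tri_vertices M j)"
    if j: "j \<in> {1..ntri M}" for j
  proof -
    obtain A c where lin: "linear A"
      and A: "\<And>x. x\<in>convex hull tri_vertices M j \<Longrightarrow> X x = A x + c"
      using fe_vec_space_affine[OF X j] by blast
    have "tri_vertices (image_mesh X M) j = X ` tri_vertices M j"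
      by (simp add: tri_vertices_def image_mesh_def image_image)
    also have "\<dots> = (\<lambda>x. c + x) ` (A ` tri_vertices M j)"
      unfolding image_image by (rule image_cong) (auto simp: A hull_inc add.commute)
    finally have "convex hull tri_vertices (image_mesh X M) j
        = (+) c ` (A ` (convex hull tri_vertices M j))"
      using lin by (simp add: convex_hull_translation convex_hull_linear_image)
    also have "\<dots> = X ` (convex hull tri_vertices M j)"
      unfolding image_image by (rule image_cong) (auto simp: A add.commute)
    finally show ?thesis .
  qed
  then show ?thesis
    unfolding surface_def closure_tri image_UN by (simp add: image_mesh_def)
qed

lemma boundary_image_mesh:
  assumes X: "X \<in> fe_vec_space M" and M: "polygonal_surface M"
  shows "boundary (image_mesh X M) = X ` boundary M"
proof -
  have "closed_segment (X (seg_vertex M i 1)) (X (seg_vertex M i 2))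
      = X ` closed_segment (seg_vertex M i 1) (seg_vertex M i 2)" if i: "i \<in> {1..nseg M}" for i
  proof -
    have "(seg_vertex M i 1, seg_vertex M i 2) \<in> tri_edges M"
      using M i unfolding polygonal_surface_def triangulation_def by blast
    then obtain jk where jk: "jk \<in> Sigma {1..ntri M} (\<lambda>_. {1, 2, 3})"
      "(seg_vertex M i 1, seg_vertex M i 2) = tri_edge M jk"
      unfolding tri_edges_def by (elim imageE)
    obtain j k where "jk = (j, k)"
      by (cases jk)
    with jk have j: "j \<in> {1..ntri M}" and k: "k = 1 \<or> k = 2 \<or> k = 3"
      and e: "seg_vertex M i 1 = tri_vertex M j k" "seg_vertex M i 2 = tri_vertex M j (k mod 3 + 1)"
      by (simp_all add: tri_edge_def)
    have "k mod 3 + 1 = 1 \<or> k mod 3 + 1 = 2 \<or> k mod 3 + 1 = 3"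
      using k by auto
    with e k have v: "seg_vertex M i 1 \<in> tri_vertices M j" "seg_vertex M i 2 \<in> tri_vertices M j"
      unfolding tri_vertices_def by blast+
    obtain A c where lin: "linear A"
      and A: "\<And>x. x\<in>convex hull tri_vertices M j \<Longrightarrow> X x = A x + c"
      using fe_vec_space_affine[OF X j] by blast
    have sub: "closed_segment (seg_vertex M i 1) (seg_vertex M i 2) \<subseteq> convex hull tri_vertices M j"
      using v by (intro closed_segment_subset) (auto simp: hull_inc)
    have "X ` closed_segment (seg_vertex M i 1) (seg_vertex M i 2)
        = (+) c ` (A ` closed_segment (seg_vertex M i 1) (seg_vertex M i 2))"
      unfolding image_image by (rule image_cong) (simp_all add: A add.commute subsetD[OF sub])
    also have "\<dots> = closed_segment (c + A (seg_vertex M i 1)) (c + A (seg_vertex M i 2))"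
      by (simp add: closed_segment_linear_image[OF lin] closed_segment_translation)
    also have "\<dots> = closed_segment (X (seg_vertex M i 1)) (X (seg_vertex M i 2))"
      using v by (simp add: A hull_inc add.commute)
    finally show ?thesis by simp
  qed
  then show ?thesis
    unfolding boundary_def image_UN image_mesh_def by simp
qed


section \<open>Inner products\<close>

text \<open>Area and arc length integrals are written through the affine parametrisations of the
  triangles over the unit triangle and of the segments over the unit interval.\<close>

definition unit_triangle :: "(real \<times> real) set" where
  "unit_triangle = {(s, t). 0 < s \<and> 0 < t \<and> s + t < 1}"

definition tri_param :: "mesh \<Rightarrow> nat \<Rightarrow> real \<times> real \<Rightarrow> real^3" where
  "tri_param M j = (\<lambda>(s, t). tri_vertex M j 1
     + s *\<^sub>R (tri_vertex M j 2 - tri_vertex M j 1)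
     + t *\<^sub>R (tri_vertex M j 3 - tri_vertex M j 1))"

definition surf_integral :: "mesh \<Rightarrow> (real^3 \<Rightarrow> real) \<Rightarrow> real" where
  "surf_integral M f = (\<Sum>j\<in>{1..ntri M}.
     norm (tri_cross M j) * (LINT z:unit_triangle|lborel. f (tri_param M j z)))"

definition bdry_integral :: "mesh \<Rightarrow> (real^3 \<Rightarrow> real) \<Rightarrow> real" where
  "bdry_integral M f = (\<Sum>j\<in>{1..nseg M}.
     seg_length M j * (LINT t:{0<..<1}|lborel. f (seg_vertex M j 1 + t *\<^sub>R seg_dir M j)))"

definition surf_inner :: "mesh \<Rightarrow> (real^3 \<Rightarrow> 'a::real_inner) \<Rightarrow> (real^3 \<Rightarrow> 'a) \<Rightarrow> real" where
  "surf_inner M f g = surf_integral M (\<lambda>x. f x \<bullet> g x)"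

definition bdry_inner :: "mesh \<Rightarrow> (real^3 \<Rightarrow> 'a::real_inner) \<Rightarrow> (real^3 \<Rightarrow> 'a) \<Rightarrow> real" where
  "bdry_inner M f g = bdry_integral M (\<lambda>x. f x \<bullet> g x)"

definition surf_norm :: "mesh \<Rightarrow> (real^3 \<Rightarrow> 'a::real_inner) \<Rightarrow> real" where
  "surf_norm M f = sqrt (surf_inner M f f)"

definition bdry_norm :: "mesh \<Rightarrow> (real^3 \<Rightarrow> 'a::real_inner) \<Rightarrow> real" where
  "bdry_norm M f = sqrt (bdry_inner M f f)"

definition vertex_limit :: "mesh \<Rightarrow> (real^3 \<Rightarrow> 'a::t2_space) \<Rightarrow> nat \<Rightarrow> nat \<Rightarrow> 'a" where
  "vertex_limit M f j k = Lim (at (tri_vertex M j k) within tri M j) f"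

definition lumped_inner :: "mesh \<Rightarrow> (real^3 \<Rightarrow> 'a::real_inner) \<Rightarrow> (real^3 \<Rightarrow> 'a) \<Rightarrow> real" where
  "lumped_inner M f g = 1/3 * (\<Sum>j\<in>{1..ntri M}. \<Sum>k\<in>{1, 2, 3}.
     tri_area M j * (vertex_limit M f j k \<bullet> vertex_limit M g j k))"


section \<open>Surface gradients and boundary derivatives\<close>

text \<open>The projection \<open>(I - n \<otimes> n) \<nabla>F\<close> is the same for all differentiable extensions \<open>F\<close> of
  the restriction of \<open>f\<close> to the open triangle containing \<open>x\<close>.\<close>

definition surf_grad :: "mesh \<Rightarrow> (real^3 \<Rightarrow> real) \<Rightarrow> real^3 \<Rightarrow> real^3" where
  "surf_grad M f x = (THE v. \<exists>F g. (\<forall>y\<in>tri M (tri_of M x). F y = f y) \<and> GDERIV F x :> g \<and>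
     v = g - (surf_normal M x \<bullet> g) *\<^sub>R surf_normal M x)"

definition dir_deriv :: "mesh \<Rightarrow> real^3 \<Rightarrow> (real^3 \<Rightarrow> real^3) \<Rightarrow> real^3 \<Rightarrow> real^3" where
  "dir_deriv M t u x = (\<chi> k. t \<bullet> surf_grad M (\<lambda>y. u y $ k) x)"

definition sym_pos_def :: "real^3^3 \<Rightarrow> bool" where
  "sym_pos_def A \<longleftrightarrow> transpose A = A \<and> (\<forall>v. v \<noteq> 0 \<longrightarrow> v \<bullet> (A *v v) > 0)"

definition aniso_mat :: "real^3^3 \<Rightarrow> real^3^3" where
  "aniso_mat A = sqrt (det A) *\<^sub>R matrix_inv A"

definition is_aniso_basis :: "real^3^3 \<Rightarrow> real^3 \<Rightarrow> (nat \<Rightarrow> real^3) \<Rightarrow> bool" where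
  "is_aniso_basis B n t \<longleftrightarrow> span (t ` {1, 2}) = {v. n \<bullet> v = 0} \<and>
     (\<forall>i\<in>{1, 2}. \<forall>j\<in>{1, 2}. t i \<bullet> (B *v t j) = (if i = j then 1 else 0))"

text \<open>\<open>B\<close> plays the role of the matrix written with a tilde on paper. The value does not depend
  on the choice of the basis.\<close>

definition aniso_prod ::
  "mesh \<Rightarrow> real^3^3 \<Rightarrow> (real^3 \<Rightarrow> real^3) \<Rightarrow> (real^3 \<Rightarrow> real^3) \<Rightarrow> real^3 \<Rightarrow> real" where
  "aniso_prod M B u w x =
     (let t = (SOME t. is_aniso_basis B (surf_normal M x) t)
      in \<Sum>i\<in>{1, 2}. dir_deriv M (t i) u x \<bullet> (B *v dir_deriv M (t i) w x))"

text \<open>Derivative with respect to the arc length of the boundary curve.\<close>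

definition arc_deriv :: "mesh \<Rightarrow> (real^3 \<Rightarrow> real^3) \<Rightarrow> real^3 \<Rightarrow> real^3" where
  "arc_deriv M f x =
     (let d = seg_dir M (seg_of M x)
      in vector_derivative (\<lambda>s. f (x + s *\<^sub>R (d /\<^sub>R norm d))) (at 0))"

definition bdry_normal_half :: "mesh \<Rightarrow> (real^3 \<Rightarrow> real^3) \<Rightarrow> real^3 \<Rightarrow> real^3" where
  "bdry_normal_half M X x = (1/2) *\<^sub>R ((arc_deriv M (\<lambda>y. y) x + arc_deriv M X x) \<times> e_z)"


section \<open>Energy and numerical scheme\<close>

definition gamma1 :: "real^3^3 \<Rightarrow> real^3 \<Rightarrow> real" where
  "gamma1 A n = sqrt (n \<bullet> (A *v n))"

definition gamma :: "nat \<Rightarrow> (nat \<Rightarrow> real^3^3) \<Rightarrow> real^3 \<Rightarrow> real" where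
  "gamma L G n = (\<Sum>i\<in>{1..L}. gamma1 (G i) n)"

definition energy :: "nat \<Rightarrow> (nat \<Rightarrow> real^3^3) \<Rightarrow> real \<Rightarrow> mesh \<Rightarrow> real" where
  "energy L G \<theta> M =
     surf_integral M (\<lambda>x. gamma L G (surf_normal M x)) - cos \<theta> * enclosed_area M"

text \<open>One step of the scheme on the surface of \<open>M\<close>, on which the old position function is the
  identity \<open>\<lambda>x. x\<close>.\<close>

definition scheme_step ::
  "real \<Rightarrow> real \<Rightarrow> real \<Rightarrow> nat \<Rightarrow> (nat \<Rightarrow> real^3^3) \<Rightarrow> mesh \<Rightarrow>
     (real^3 \<Rightarrow> real^3) \<Rightarrow> (real^3 \<Rightarrow> real) \<Rightarrow> bool" where
  "scheme_step \<tau> \<eta> \<theta> L G M X \<mu> \<longleftrightarrow>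
     X \<in> fe_vec_space M \<and> \<mu> \<in> fe_space M \<and>
     (\<forall>\<psi>\<in>fe_space M.
        lumped_inner M (\<lambda>x. (X x - x) /\<^sub>R \<tau>) (\<lambda>x. \<psi> x *\<^sub>R surf_normal M x)
        + surf_inner M (surf_grad M \<mu>) (surf_grad M \<psi>) = 0) \<and>
     (\<forall>g\<in>fe_vec_space M.
        lumped_inner M (\<lambda>x. \<mu> x *\<^sub>R surf_normal M x) g
        - (\<Sum>i\<in>{1..L}. surf_inner M (\<lambda>x. gamma1 (G i) (surf_normal M x))
                                     (aniso_prod M (aniso_mat (G i)) X g))
        + cos \<theta> * bdry_inner M (bdry_normal_half M X) g
        - 1 / (\<eta> * \<tau>) * bdry_inner M (\<lambda>x. (X x - x) \<bullet> bdry_normal M x)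
                                       (\<lambda>x. g x \<bullet> bdry_normal M x) = 0)"

end

theory Submission
  imports Defs
begin

text \<open>
  Testing the scheme with \<open>\<psi> = \<mu>\<close> and \<open>g = X - id\<close> eliminates the lumped product and leaves a balance
  of three terms. The anisotropic term dominates the increment of the surface energy: the matrix
  with a tilde has cofactor matrix \<open>G\<close>, so by AM-GM half the anisotropic Dirichlet density of an
  affine map is at least its stretching of \<open>\<gamma>\<close>-weighted area, with equality for the identity.
  The contact angle term equals the increment of the enclosed area exactly, since by the shoelace
  formula this area is a quadratic function of the vertices and the averaged normal is a midpoint
  rule for it; exactness matters because \<open>cos \<theta>\<close> has no sign. The shoelace formula itself follows
  by integrating the winding number, which almost everywhere is the sum of the winding numbers of
  the triangles joining the edges to the origin.
\<close>

section \<open>The area enclosed by a polygon\<close>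

text \<open>The fields of the scheme are read off through choices (\<open>tri_of\<close>,
  \<open>seg_of\<close>, the basis picked by \<open>SOME\<close> in \<open>aniso_prod\<close>), so
  an integral can be evaluated only after these are seen to be constant on each open triangle or
  segment. For segments this rests on the simplicity of the boundary loop, because
  \<open>polygonal_surface\<close> demands disjointness explicitly only of the triangles. The scheme
  pairs the new map with the displacement, that is p with p - q, and not with an increment of
  squares. The link to AM-GM is p \<bullet> B(p - q) \<ge> (p \<bullet> Bp - q \<bullet> Bq) / 2,
  whose defect is half the squared B-length of p - q. For q = t_i it leaves half the Dirichlet
  density of X minus 1, and 1 is the weighted area of t_1 \<times> t_2. The orientation in the mesh
  type fixes the sign of the shoelace formula, and the new mesh is assumed to be of that type, so
  old and new area obey the same formula. Averaging the old and the new tangent in the boundary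
  normal makes the mixed products of an end point with the image of the other one cancel; what is
  left over sums to 0 around the loop.\<close>

lemma lborel_distr_real2_complex:
  "(lborel :: complex measure) = distr lborel borel (\<lambda>x::real^2. Complex (x$1) (x$2))"
proof (rule lborel_eqI)
  have [measurable]: "(\<lambda>x::real^2. Complex (x$1) (x$2)) \<in> borel_measurable borel"
    by (intro borel_measurable_continuous_onI continuous_intros)
  fix l u :: complex assume le: "\<And>b. b \<in> Basis \<Longrightarrow> l \<bullet> b \<le> u \<bullet> b"
  define l' u' :: "real^2" where "l' = vector [Re l, Im l]" and "u' = vector [Re u, Im u]"
  have [simp]: "l'$1 = Re l" "l'$2 = Im l" "u'$1 = Re u" "u'$2 = Im u"
    by (simp_all add: l'_def u'_def)
  have le': "Re l \<le> Re u" "Im l \<le> Im u"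
    using le[of 1] le[of \<i>] by (simp_all add: Basis_complex_def)
  have vim: "(\<lambda>x::real^2. Complex (x$1) (x$2)) -` box l u = box l' u'"
    by (auto simp: box_def Basis_complex_def Basis_vec_def inner_axis forall_2)
  have B: "(Basis :: (real^2) set) = {axis 1 1, axis 2 1}"
    by (auto simp: Basis_vec_def UNIV_2)
  have ne: "axis 1 1 \<noteq> (axis 2 1 :: real^2)"
    by (simp add: axis_eq_axis)
  have "emeasure (lborel :: (real^2) measure) (box l' u') = (\<Prod>b\<in>Basis. (u' - l') \<bullet> b)"
    by (rule emeasure_lborel_box) (use le' in \<open>auto simp: B inner_axis\<close>)
  also have "(\<Prod>b\<in>Basis. (u' - l') \<bullet> b) = (\<Prod>b\<in>Basis. (u - l) \<bullet> b)"
    using ne by (simp add: B Basis_complex_def inner_axis)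
  finally show "emeasure (distr lborel borel (\<lambda>x::real^2. Complex (x$1) (x$2))) (box l u)
      = (\<Prod>b\<in>Basis. (u - l) \<bullet> b)"
    by (simp add: emeasure_distr vim)
qed simp

text \<open>\<open>content_triangle\<close> concerns \<open>real^2\<close>; it transfers because the
  identification \<open>?f\<close> carries Lebesgue measure to Lebesgue measure.\<close>

lemma measure_complex_triangle:
  fixes a b c :: complex
  shows "measure lebesgue (convex hull {a, b, c}) = \<bar>Im (cnj (b - a) * (c - a))\<bar> / 2"
proof -
  let ?f = "\<lambda>x::real^2. Complex (x$1) (x$2)"
  have [measurable]: "?f \<in> borel_measurable borel"
    by (intro borel_measurable_continuous_onI continuous_intros)
  let ?g = "\<lambda>z::complex. (vector [Re z, Im z] :: real^2)"
  have lin: "linear ?g"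
    by (auto intro!: linearI simp: vec_eq_iff forall_2)
  have fg: "?f (?g z) = z" for z by (simp add: complex_eq_iff)
  have gf: "?g (?f x) = x" for x by (simp add: vec_eq_iff forall_2)
  have "?f -` (convex hull {a, b, c}) = ?g ` (convex hull {a, b, c})"
    using fg by (auto simp: image_iff) (metis gf)
  also have "\<dots> = convex hull {?g a, ?g b, ?g c}"
    by (simp add: convex_hull_linear_image[OF lin])
  finally have vim: "?f -` (convex hull {a, b, c}) = convex hull {?g a, ?g b, ?g c}" .
  have meas: "convex hull {a, b, c} \<in> sets borel"
    by (simp add: compact_imp_closed finite_imp_compact_convex_hull borel_closed)
  have "measure lebesgue (convex hull {a, b, c}) = measure lborel (convex hull {a, b, c})"
    using meas by (simp add: measure_completion)
  also have "\<dots> = measure (distr lborel borel ?f) (convex hull {a, b, c})"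
    by (simp add: lborel_distr_real2_complex[symmetric])
  also have "\<dots> = measure lborel (convex hull {?g a, ?g b, ?g c})"
    using meas by (simp add: measure_distr vim)
  also have "\<dots> = \<bar>Im (cnj (b - a) * (c - a))\<bar> / 2"
    by (simp add: content_triangle algebra_simps)
  finally show ?thesis .
qed

lemma has_integral_winding_number_triangle:
  fixes a b c :: complex
  shows "((\<lambda>z. Re (winding_number (linepath a b +++ linepath b c +++ linepath c a) z))
           has_integral Im (cnj (b - a) * (c - a)) / 2) UNIV"
proof -
  define T where "T = convex hull {a, b, c}"
  define d where "d = Im (cnj (b - a) * (c - a))"
  \<comment> \<open>The value -1 at \<open>d = 0\<close> is harmless: the triangle is then a null
    set without interior points.\<close>
  define s :: real where "s = (if 0 < d then 1 else -1)"
  let ?p = "linepath a b +++ linepath b c +++ linepath c a"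
  have T: "convex T" "bounded T" "closed T"
    by (simp_all add: T_def finite_imp_bounded_convex_hull finite_imp_compact_convex_hull
        compact_imp_closed)
  have "(indicator T has_integral measure lebesgue T) UNIV"
    using measurable_convex[OF T(1,2)] by (simp add: lmeasurable_iff_has_integral)
  then have "((\<lambda>z. s * indicator T z) has_integral s * measure lebesgue T) UNIV"
    by (rule has_integral_mult_right)
  moreover have "s * measure lebesgue T = d / 2"
    by (simp add: T_def measure_complex_triangle d_def s_def)
  ultimately have int: "((\<lambda>z. s * indicator T z) has_integral d / 2) UNIV" by simp
  have "Re (winding_number ?p z) = s * indicator T z" if z: "z \<notin> frontier T" for z
  proof (cases "z \<in> T")
    case False
    have sub: "path_image ?p \<subseteq> T"
      unfolding T_def by (auto simp: path_image_join segment_convex_hull intro: hull_mono[THEN subsetD, rotated])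
    have "winding_number ?p z = 0"
      by (rule winding_number_zero_outside[OF _ T(1) _ False sub]) auto
    then show ?thesis using False by simp
  next
    case True
    then have int: "z \<in> interior (convex hull {a, b, c})"
      using z T(3) by (simp add: frontier_def T_def)
    obtain \<alpha> \<beta> \<gamma> where abc: "\<alpha> \<ge> 0" "\<beta> \<ge> 0" "\<gamma> \<ge> 0" "\<alpha> + \<beta> + \<gamma> = 1"
      and zeq: "z = \<alpha> *\<^sub>R a + \<beta> *\<^sub>R b + \<gamma> *\<^sub>R c"
      using True unfolding T_def convex_hull_3 by blast
    have "\<gamma> \<noteq> 0"
    proof
      assume "\<gamma> = 0"
      then have "z = (1 - \<beta>) *\<^sub>R a + \<beta> *\<^sub>R b" "\<beta> \<le> 1" "0 \<le> \<beta>"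
        using abc zeq by (simp_all flip: abc(4))
      then have "z \<in> closed_segment a b"
        using abc by (auto simp: closed_segment_def)
      then show False using int interior_of_triangle[of a b c] by auto
    qed
    then have "\<gamma> > 0" using abc by simp
    have \<alpha>: "\<alpha> = 1 - \<beta> - \<gamma>" using abc by simp
    \<comment> \<open>\<open>winding_number_triangle\<close> reads the orientation off the sign of
      this quantity, which depends on \<open>z\<close>; the positive barycentric coordinate
      \<open>\<gamma>\<close> reduces it to the sign of \<open>d\<close>.\<close>
    have "Im ((b - a) * cnj (b - z)) = \<gamma> * d"
      unfolding zeq d_def \<alpha> by (simp add: algebra_simps)
    then have "winding_number ?p z = of_real s"
      using winding_number_triangle[OF int] \<open>\<gamma> > 0\<close> by (simp add: s_def zero_less_mult_iff)
    then show ?thesis using True by simp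
  qed
  then show ?thesis
    unfolding d_def[symmetric]
    by (intro has_integral_spike[OF negligible_convex_frontier[OF T(1)] _ int]) auto
qed

section \<open>Polygonal paths: image and winding number, edge by edge\<close>

lemma path_polygonal_path [simp]: "path (polygonal_path ps)"
  and pathstart_polygonal_path: "ps \<noteq> [] \<Longrightarrow> pathstart (polygonal_path ps) = hd ps"
  and pathfinish_polygonal_path: "ps \<noteq> [] \<Longrightarrow> pathfinish (polygonal_path ps) = last ps"
proof -
  have [simp]: "path (\<lambda>_. c)" "pathstart (\<lambda>_. c) = c" "pathfinish (\<lambda>_. c) = c" for c :: complex
    by (simp_all add: path_def pathstart_def pathfinish_def)
  have "path (polygonal_path ps) \<and> (ps \<noteq> [] \<longrightarrow> pathstart (polygonal_path ps) = hd ps \<and>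
    pathfinish (polygonal_path ps) = last ps)"
    by (induction ps rule: polygonal_path.induct) auto
  then show "path (polygonal_path ps)"
    "ps \<noteq> [] \<Longrightarrow> pathstart (polygonal_path ps) = hd ps"
    "ps \<noteq> [] \<Longrightarrow> pathfinish (polygonal_path ps) = last ps" by auto
qed

lemma path_image_polygonal_path:
  "length ps \<ge> 2 \<Longrightarrow> path_image (polygonal_path ps)
     = (\<Union>i<length ps - 1. closed_segment (ps ! i) (ps ! Suc i))"
proof (induction ps rule: polygonal_path.induct)
  case (4 a b c as)
  have "path_image (polygonal_path (a # b # c # as))
     = closed_segment a b \<union> path_image (polygonal_path (b # c # as))"
    by (simp add: path_image_join pathstart_polygonal_path)
  also have "\<dots> = closed_segment a b \<union>
     (\<Union>i<length as + 1. closed_segment ((b # c # as) ! i) ((b # c # as) ! Suc i))"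
    using "4.IH" by simp
  finally show ?case
    using UN_le_add_shift_strict[of _ 0]
    by (simp add: lessThan_Suc_eq_insert_0 image_image)
qed auto

text \<open>Short lists are covered: they give a constant path, whose winding number is 0 like the
  empty sum.\<close>

lemma winding_number_polygonal_path:
  "z \<notin> path_image (polygonal_path ps) \<Longrightarrow> winding_number (polygonal_path ps) z
     = (\<Sum>i<length ps - 1. winding_number (linepath (ps ! i) (ps ! Suc i)) z)"
proof (induction ps rule: polygonal_path.induct)
  case (4 a b c as)
  then have "z \<notin> closed_segment a b" "z \<notin> path_image (polygonal_path (b # c # as))"
    by (auto simp: path_image_join pathstart_polygonal_path)
  then show ?case
    using 4 by (simp add: winding_number_join pathstart_polygonal_path
        del: sum.lessThan_Suc add: sum.lessThan_Suc_shift)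
qed auto

lemma negligible_closed_segment:
  fixes a b :: complex
  shows "negligible (closed_segment a b)"
proof -
  have "interior (closed_segment a b) = {}" by (simp add: interior_closed_segment_ge2)
  then show ?thesis
    by (metis negligible_convex_interior convex_closed_segment)
qed

lemma negligible_path_image_polygonal_path:
  assumes "ps \<noteq> []"
  shows "negligible (path_image (polygonal_path ps))"
proof (cases "length ps \<ge> 2")
  case True
  then show ?thesis
    by (auto simp: path_image_polygonal_path intro!: negligible_Union negligible_closed_segment)
next
  case False
  then obtain a where "ps = [a]" using assms by (cases ps; cases "tl ps") auto
  then show ?thesis by (simp add: path_image_def image_constant_conv)
qed

text \<open>Neighbouring triangles traverse their common spoke from 0 in opposite directions, so the
  spokes telescope, and the first and last one cancel because the list is closed.
  \<open>Im (cnj p * q) / 2\<close> is the signed area of the triangle 0, p, q.\<close>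

lemma integral_winding_number_polygonal_path:
  assumes "ps \<noteq> []" "hd ps = last ps"
  shows "((\<lambda>z. Re (winding_number (polygonal_path ps) z)) has_integral
      (\<Sum>i<length ps - 1. Im (cnj (ps ! i) * ps ! Suc i)) / 2) UNIV"
proof -
  let ?n = "length ps - 1"
  let ?W = "\<lambda>a b z. winding_number (linepath a b) z"
  let ?t = "\<lambda>i. linepath 0 (ps ! i) +++ linepath (ps ! i) (ps ! Suc i) +++ linepath (ps ! Suc i) 0"
  \<comment> \<open>Winding numbers of single segments add up only at points off all edges and
    spokes.\<close>
  define N where "N = path_image (polygonal_path ps) \<union> (\<Union>i<length ps. closed_segment 0 (ps ! i))
    \<union> (\<Union>i<?n. closed_segment (ps ! i) (ps ! Suc i))"
  have negN: "negligible N"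
    using negligible_path_image_polygonal_path[OF assms(1)]
    unfolding N_def by (auto intro!: negligible_Union negligible_closed_segment)
  have int: "((\<lambda>z. \<Sum>i<?n. Re (winding_number (?t i) z)) has_integral
      (\<Sum>i<?n. Im (cnj (ps ! i - 0) * (ps ! Suc i - 0)) / 2)) UNIV"
    by (intro has_integral_sum has_integral_winding_number_triangle) auto
  have "(\<Sum>i<?n. Re (winding_number (?t i) z)) = Re (winding_number (polygonal_path ps) z)"
    if z: "z \<notin> N" for z
  proof -
    have z0: "z \<notin> closed_segment 0 (ps ! i)" "z \<notin> closed_segment (ps ! i) 0" if "i < length ps" for i
      using z that unfolding N_def by (auto simp: closed_segment_commute)
    have "winding_number (?t i) z = ?W (ps ! i) (ps ! Suc i) z + (?W 0 (ps ! i) z - ?W 0 (ps ! Suc i) z)"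
      if i: "i < ?n" for i
    proof -
      have zi: "z \<notin> closed_segment (ps ! i) (ps ! Suc i)" using z i by (auto simp: N_def)
      have "?W (ps ! Suc i) 0 z = - ?W 0 (ps ! Suc i) z"
        using winding_number_reversepath[of "linepath 0 (ps ! Suc i)" z] z0[of "Suc i"] i by simp
      then show ?thesis
        using zi z0[of i] z0[of "Suc i"] i by (simp add: winding_number_join path_image_join)
    qed
    then have "(\<Sum>i<?n. winding_number (?t i) z)
      = (\<Sum>i<?n. ?W (ps ! i) (ps ! Suc i) z) + (?W 0 (ps ! 0) z - ?W 0 (ps ! ?n) z)"
      using sum_lessThan_telescope'[of "\<lambda>i. ?W 0 (ps ! i) z" ?n] by (simp add: sum.distrib)
    also have "\<dots> = winding_number (polygonal_path ps) z"
      using z assms by (simp add: N_def winding_number_polygonal_path hd_conv_nth last_conv_nth)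
    finally show ?thesis by (metis Re_sum)
  qed
  then show ?thesis
    using has_integral_spike[OF negN _ int, of "\<lambda>z. Re (winding_number (polygonal_path ps) z)"]
    by (simp add: sum_divide_distrib)
qed

text \<open>Off the curve, a null set, the winding number is 1 inside and 0 outside, hence the
  indicator of the inside; its integral is computed in two ways.\<close>

lemma measure_inside_polygonal_path:
  assumes "ps \<noteq> []" "hd ps = last ps"
    and wn: "\<And>z. z \<in> inside (path_image (polygonal_path ps))
               \<Longrightarrow> winding_number (polygonal_path ps) z = 1"
  shows "measure lebesgue (inside (path_image (polygonal_path ps)))
     = (\<Sum>i<length ps - 1. Im (cnj (ps ! i) * ps ! Suc i)) / 2"
proof -
  let ?p = "polygonal_path ps"
  let ?I = "inside (path_image ?p)"
  have "open ?I" "bounded ?I"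
    by (auto intro!: open_inside bounded_inside closed_path_image bounded_path_image)
  then have "?I \<in> lmeasurable"
    by (simp add: lmeasurable_open)
  then have I: "(indicator ?I has_integral measure lebesgue ?I) UNIV"
    by (simp add: lmeasurable_iff_has_integral)
  have neg: "negligible (path_image ?p)"
    using assms(1) by (rule negligible_path_image_polygonal_path)
  have "Re (winding_number ?p z) = indicator ?I z" if "z \<notin> path_image ?p" for z
  proof (cases "z \<in> ?I")
    case False
    then have "z \<in> outside (path_image ?p)"
      using that inside_Un_outside[of "path_image ?p"] by blast
    then have "winding_number ?p z = 0"
      using assms by (intro winding_number_zero_in_outside)
         (auto simp: pathstart_polygonal_path pathfinish_polygonal_path)
    then show ?thesis using False by simp
  qed (simp add: wn)
  then have "((\<lambda>z. Re (winding_number ?p z)) has_integral measure lebesgue ?I) UNIV"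
    by (intro has_integral_spike[OF neg _ I]) auto
  then show ?thesis
    using integral_winding_number_polygonal_path[OF assms(1,2)] has_integral_unique by blast
qed

section \<open>The boundary curve\<close>

text \<open>The tail of an arc is an arc and meets the first edge only in their common end point, so
  induction on the list works.\<close>

lemma arc_polygonal_path_disjoint:
  assumes "arc (polygonal_path ps)" "i < j" "j < length ps - 1"
  shows "open_segment (ps ! i) (ps ! Suc i) \<inter> open_segment (ps ! j) (ps ! Suc j) = {}"
  using assms
proof (induction ps arbitrary: i j rule: polygonal_path.induct)
  case (4 a b c as)
  have arc: "arc (polygonal_path (b # c # as))"
    and ab: "closed_segment a b \<inter> path_image (polygonal_path (b # c # as)) \<subseteq> {b}"
    using "4.prems"(1) by (auto simp: arc_join_eq pathstart_polygonal_path)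
  show ?case
  proof (cases i)
    case 0
    then obtain k where j: "j = Suc k" "k < length as + 1" using "4.prems" by (cases j) auto
    have "open_segment ((b # c # as) ! k) ((b # c # as) ! Suc k)
      \<subseteq> path_image (polygonal_path (b # c # as))"
      using j segment_open_subset_closed by (subst path_image_polygonal_path) fastforce+
    then show ?thesis
      using ab segment_open_subset_closed[of a b] 0 j by (auto simp: open_segment_def)
  next
    case (Suc k)
    then show ?thesis
      using "4.IH"[OF arc, of k "j - 1"] "4.prems" by (cases j) auto
  qed
qed auto

text \<open>A loop is not an arc, but it becomes one when the first edge is removed; that edge meets
  the rest only in its two end points.\<close>

lemma simple_loop_polygonal_path_disjoint:
  assumes "simple_path (polygonal_path ps)" "hd ps = last ps" "i < j" "j < length ps - 1"
  shows "open_segment (ps ! i) (ps ! Suc i) \<inter> open_segment (ps ! j) (ps ! Suc j) = {}"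
proof -
  obtain a b c as where ps: "ps = a # b # c # as"
    using assms(3,4) by (cases ps rule: polygonal_path.cases) auto
  have "arc (polygonal_path (b # c # as))"
    and ab: "closed_segment a b \<inter> path_image (polygonal_path (b # c # as)) \<subseteq> {a, b}"
    using assms(1,2) unfolding ps
    by (auto simp: simple_path_join_loop_eq pathstart_polygonal_path pathfinish_polygonal_path)
  show ?thesis
  proof (cases i)
    case 0
    then obtain k where j: "j = Suc k" "k < length as + 1" using assms ps by (cases j) auto
    have "open_segment ((b # c # as) ! k) ((b # c # as) ! Suc k)
      \<subseteq> path_image (polygonal_path (b # c # as))"
      using j segment_open_subset_closed by (subst path_image_polygonal_path) fastforce+
    then show ?thesis
      using ab segment_open_subset_closed[of a b] 0 j ps by (auto simp: open_segment_def)
  next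
    case (Suc k)
    then show ?thesis
      using arc_polygonal_path_disjoint[OF \<open>arc (polygonal_path (b # c # as))\<close>, of k "j - 1"]
        assms ps by (cases j) auto
  qed
qed

lemma linear_plane_proj: "linear plane_proj"
  by (intro linearI) (auto simp: plane_proj_def complex_eq_iff)

text \<open>The list inside \<open>boundary_path\<close>, named so that the lemmas on
  \<open>polygonal_path\<close> apply. Positions count from 0 and segments from 1, hence the shifts
  by \<open>Suc\<close> below.\<close>

definition boundary_vertices :: "mesh \<Rightarrow> complex list" where
  "boundary_vertices M =
     map (\<lambda>j. plane_proj (seg_vertex M j 1)) [1..<nseg M + 1] @ [plane_proj (seg_vertex M 1 1)]"

lemma boundary_path_eq: "boundary_path M = polygonal_path (boundary_vertices M)"
  by (simp add: boundary_path_def boundary_vertices_def)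

lemma boundary_vertices:
  shows "length (boundary_vertices M) = Suc (nseg M)"
    and "hd (boundary_vertices M) = last (boundary_vertices M)"
    and "i < nseg M \<Longrightarrow> boundary_vertices M ! i = plane_proj (seg_vertex M (Suc i) 1)"
  by (auto simp: boundary_vertices_def nth_append hd_append hd_map simp del: upt_Suc)

lemma seg_vertex_next:
  "polygonal_surface M \<Longrightarrow> j \<in> {1..nseg M} \<Longrightarrow> seg_vertex M j 2 = seg_vertex M (j mod nseg M + 1) 1"
  by (auto simp: polygonal_surface_def)

lemma boundary_vertices_Suc:
  assumes "polygonal_surface M" "i < nseg M"
  shows "boundary_vertices M ! Suc i = plane_proj (seg_vertex M (Suc i) 2)"
proof -
  have "seg_vertex M (Suc i) 2 = seg_vertex M (Suc i mod nseg M + 1) 1"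
    using assms by (intro seg_vertex_next) auto
  then show ?thesis
    using assms(2) by (cases "Suc i = nseg M")
      (auto simp: boundary_vertices_def nth_append simp del: upt_Suc)
qed

lemma nseg_pos:
  assumes "polygonal_surface M"
  shows "nseg M > 0"
proof (rule ccontr)
  assume "\<not> nseg M > 0"
  then have "boundary_path M = (\<lambda>_. plane_proj (seg_vertex M 1 1))"
    by (simp add: boundary_path_def linepath_def flip: scaleR_add_left)
  moreover have "simple_path (boundary_path M)" using assms by (simp add: polygonal_surface_def)
  ultimately have "loop_free (\<lambda>_. plane_proj (seg_vertex M 1 1))" by (simp add: simple_path_def)
  then show False
    \<comment> \<open>The parameters 0 and 1/2 are compared since \<open>loop_free\<close> lets 0
      and 1 coincide.\<close>
    unfolding loop_free_def by (force dest: bspec[where x="1/2"] bspec[where x=0])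
qed

lemma sum_lessThan_Suc_eq: "(\<Sum>i<n. f (Suc i)) = (\<Sum>j\<in>{1..n}. f j)"
  by (rule sum.reindex_bij_witness[of _ "\<lambda>j. j - 1" Suc]) auto

text \<open>In the plane, \<open>Im (cnj p * q)\<close> is the third component of the cross product
  of the two points.\<close>

lemma enclosed_area_eq:
  assumes M: "polygonal_surface M"
  shows "enclosed_area M = (\<Sum>j\<in>{1..nseg M}. (seg_vertex M j 1 \<times> seg_vertex M j 2) \<bullet> e_z) / 2"
proof -
  let ?ps = "boundary_vertices M"
  have n: "nseg M > 0" using nseg_pos[OF M] .
  have "plane_proj ` boundary M
      = (\<Union>j\<in>{1..nseg M}. closed_segment (plane_proj (seg_vertex M j 1)) (plane_proj (seg_vertex M j 2)))"
    by (simp add: boundary_def image_UN closed_segment_linear_image[OF linear_plane_proj])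
  also have "\<dots> = (\<Union>i<nseg M. closed_segment (?ps ! i) (?ps ! Suc i))"
  proof -
    have "{1..nseg M} = Suc ` {..<nseg M}" by (simp add: image_Suc_lessThan)
    then show ?thesis by (simp add: boundary_vertices boundary_vertices_Suc[OF M])
  qed
  also have "\<dots> = path_image (polygonal_path ?ps)"
    using n by (simp add: path_image_polygonal_path boundary_vertices)
  finally have img: "plane_proj ` boundary M = path_image (polygonal_path ?ps)" .
  have "enclosed_area M = (\<Sum>i<nseg M. Im (cnj (?ps ! i) * ?ps ! Suc i)) / 2"
    unfolding enclosed_area_def img
    using M boundary_vertices[where M=M]
    by (subst measure_inside_polygonal_path)
      (auto simp: polygonal_surface_def boundary_path_eq boundary_vertices_def)
  also have "(\<Sum>i<nseg M. Im (cnj (?ps ! i) * ?ps ! Suc i))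
      = (\<Sum>i<nseg M. (seg_vertex M (Suc i) 1 \<times> seg_vertex M (Suc i) 2) \<bullet> e_z)"
    by (intro sum.cong) (auto simp: boundary_vertices boundary_vertices_Suc[OF M] plane_proj_def
        e_z_def cross3_simps)
  finally show ?thesis
    using sum_lessThan_Suc_eq[of "\<lambda>j. (seg_vertex M j 1 \<times> seg_vertex M j 2) \<bullet> e_z"] by simp
qed

text \<open>Boundary segments are exactly the directed edges whose reversal is absent; a degenerate
  one would be its own reversal.\<close>

lemma seg_vertex_distinct:
  assumes M: "polygonal_surface M" and j: "j \<in> {1..nseg M}"
  shows "seg_vertex M j 1 \<noteq> seg_vertex M j 2"
proof
  assume eq: "seg_vertex M j 1 = seg_vertex M j 2"
  have "(seg_vertex M j 1, seg_vertex M j 2) \<in> tri_edges M"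
    and nin: "(seg_vertex M j 2, seg_vertex M j 1) \<notin> tri_edges M"
    using M j unfolding polygonal_surface_def triangulation_def by blast+
  then show False using eq by simp
qed

lemma seg_disjoint:
  assumes M: "polygonal_surface M" and ij: "i \<in> {1..nseg M}" "j \<in> {1..nseg M}" "i \<noteq> j"
  shows "seg M i \<inter> seg M j = {}"
proof -
  have *: "seg M i \<inter> seg M j = {}" if ij: "i \<in> {1..nseg M}" "j \<in> {1..nseg M}" "i < j" for i j
  proof -
    let ?ps = "boundary_vertices M"
    \<comment> \<open>Since the curve lies in the plane where the third coordinate is 0, the
      projection is injective on it and sends no inner point of a segment to an end point.\<close>
    have proj: "plane_proj ` seg M k \<subseteq> open_segment (?ps ! (k - 1)) (?ps ! Suc (k - 1))"
      if k: "k \<in> {1..nseg M}" for k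
    proof -
      have sub: "closed_segment (seg_vertex M k 1) (seg_vertex M k 2) \<subseteq> boundary M"
        using k by (auto simp: boundary_def)
      have z: "x $ 3 = 0" if "x \<in> closed_segment (seg_vertex M k 1) (seg_vertex M k 2)" for x
        using M sub that unfolding polygonal_surface_def by blast
      have inj: "inj_on plane_proj (closed_segment (seg_vertex M k 1) (seg_vertex M k 2))"
        using z by (auto simp: inj_on_def plane_proj_def vec_eq_iff forall_3)
      have "plane_proj ` seg M k
          = plane_proj ` closed_segment (seg_vertex M k 1) (seg_vertex M k 2)
            - plane_proj ` {seg_vertex M k 1, seg_vertex M k 2}"
        unfolding seg_def open_segment_def
        by (rule inj_on_image_set_diff[OF inj]) auto
      also have "\<dots> = open_segment (plane_proj (seg_vertex M k 1)) (plane_proj (seg_vertex M k 2))"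
        by (simp add: closed_segment_linear_image[OF linear_plane_proj] open_segment_def)
      finally show ?thesis
        using k boundary_vertices(3)[where i="k - 1" and M=M] boundary_vertices_Suc[OF M, of "k - 1"] by auto
    qed
    have "open_segment (?ps ! (i - 1)) (?ps ! Suc (i - 1))
        \<inter> open_segment (?ps ! (j - 1)) (?ps ! Suc (j - 1)) = {}"
      using M ij by (intro simple_loop_polygonal_path_disjoint)
        (auto simp: polygonal_surface_def boundary_path_eq boundary_vertices)
    then show ?thesis using proj[of i] proj[of j] ij by blast
  qed
  show ?thesis using ij *[of i j] *[of j i] by (cases i j rule: linorder_cases) auto
qed

section \<open>Fields along the boundary segments and the contact angle term\<close>

lemma seg_of_eq:
  assumes "polygonal_surface M" "j \<in> {1..nseg M}" "x \<in> seg M j"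
  shows "seg_of M x = j"
  unfolding seg_of_def using seg_disjoint[OF assms(1)] assms(2,3) by (intro the_equality) blast+

lemma fe_vec_space_affine_segment:
  assumes X: "X \<in> fe_vec_space M" and M: "polygonal_surface M" and i: "i \<in> {1..nseg M}"
  shows "\<exists>A c. linear A \<and>
    (\<forall>x\<in>closed_segment (seg_vertex M i 1) (seg_vertex M i 2). X x = A x + c)"
proof -
  have "(seg_vertex M i 1, seg_vertex M i 2) \<in> tri_edges M"
    using M i unfolding polygonal_surface_def triangulation_def by blast
  then obtain p where p: "p \<in> Sigma {1..ntri M} (\<lambda>_. {1, 2, 3})"
    "(seg_vertex M i 1, seg_vertex M i 2) = tri_edge M p"
    unfolding tri_edges_def by blast
  define j k where "j = fst p" and "k = snd p"
  have j: "j \<in> {1..ntri M}" and k: "k \<in> {1, 2, 3}"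
    and e: "seg_vertex M i 1 = tri_vertex M j k" "seg_vertex M i 2 = tri_vertex M j (k mod 3 + 1)"
    using p by (auto simp: j_def k_def tri_edge_def split: prod.splits)
  have "k mod 3 + 1 \<in> {1, 2, 3}" using k by auto
  then have "seg_vertex M i 1 \<in> tri_vertices M j" "seg_vertex M i 2 \<in> tri_vertices M j"
    using k e unfolding tri_vertices_def by blast+
  then have "closed_segment (seg_vertex M i 1) (seg_vertex M i 2) \<subseteq> convex hull tri_vertices M j"
    by (intro closed_segment_subset) (auto simp: hull_inc)
  then show ?thesis using fe_vec_space_affine[OF X j] by blast
qed

lemma seg_param_in_seg:
  assumes "polygonal_surface M" "j \<in> {1..nseg M}" "0 < t" "t < 1"
  shows "seg_vertex M j 1 + t *\<^sub>R seg_dir M j \<in> seg M j"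
  unfolding seg_def in_segment seg_dir_def
  using seg_vertex_distinct[OF assms(1,2)] assms(3,4)
  by (auto intro!: exI[of _ t] simp: algebra_simps)

lemma arc_deriv_affine:
  assumes M: "polygonal_surface M" and j: "j \<in> {1..nseg M}" and t: "0 < t" "t < 1"
    and A: "linear A"
    and f: "\<And>x. x \<in> closed_segment (seg_vertex M j 1) (seg_vertex M j 2) \<Longrightarrow> f x = A x + c"
  shows "arc_deriv M f (seg_vertex M j 1 + t *\<^sub>R seg_dir M j)
    = A (seg_dir M j) /\<^sub>R seg_length M j"
proof -
  let ?a = "seg_vertex M j 1" and ?d = "seg_dir M j" and ?l = "seg_length M j"
  define x where "x = ?a + t *\<^sub>R ?d"
  have l: "?l > 0" "norm ?d = ?l"
    using seg_vertex_distinct[OF M j] by (simp_all add: seg_length_def seg_dir_def)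
  have xs: "seg_of M x = j"
    unfolding x_def using seg_of_eq[OF M j] seg_param_in_seg[OF M j t] by blast
  \<comment> \<open>Arc length \<open>s\<close> shifts the segment parameter by
    \<open>s / ?l\<close>; \<open>S\<close> collects the \<open>s\<close> that stay on the open
    segment, where \<open>f\<close> is known to be affine.\<close>
  define S where "S = {s. 0 < t + s / ?l \<and> t + s / ?l < 1}"
  have "open S"
    unfolding S_def by (intro open_Collect_conj open_Collect_less continuous_intros) (use l in auto)
  have "0 \<in> S" using t by (simp add: S_def)
  have eq: "A x + c + s *\<^sub>R (A ?d /\<^sub>R ?l) = f (x + s *\<^sub>R (?d /\<^sub>R ?l))" if "s \<in> S" for s
  proof -
    have "x + s *\<^sub>R (?d /\<^sub>R ?l) = ?a + (t + s / ?l) *\<^sub>R ?d"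
      by (simp add: x_def algebra_simps divide_inverse)
    moreover have "\<dots> \<in> seg M j"
      using that by (intro seg_param_in_seg[OF M j]) (auto simp: S_def)
    ultimately have "x + s *\<^sub>R (?d /\<^sub>R ?l) \<in> closed_segment ?a (seg_vertex M j 2)"
      using segment_open_subset_closed unfolding seg_def by auto
    then show ?thesis
      using A by (simp add: f linear_add linear_scale)
  qed
  have "((\<lambda>s. A x + c + s *\<^sub>R (A ?d /\<^sub>R ?l)) has_vector_derivative A ?d /\<^sub>R ?l) (at 0)"
    by (auto intro!: derivative_eq_intros)
  then have "((\<lambda>s. f (x + s *\<^sub>R (?d /\<^sub>R ?l))) has_vector_derivative A ?d /\<^sub>R ?l) (at 0)"
    using \<open>open S\<close> \<open>0 \<in> S\<close> eq by (rule has_vector_derivative_transform_within_open)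
  then show ?thesis
    unfolding arc_deriv_def x_def[symmetric] xs Let_def l(2) by (rule vector_derivative_at)
qed

lemma set_integral_affine_unit_interval:
  fixes \<alpha> \<beta> :: real
  shows "(LINT t:{0<..<1}|lborel. \<alpha> + t * \<beta>) = \<alpha> + \<beta> / 2"
proof -
  have "(LINT t:{0<..<1}|lborel. \<alpha> + t * \<beta>) = (LBINT t=0..1. \<alpha> + t * \<beta>)"
    by (simp add: interval_lebesgue_integral_def zero_ereal_def one_ereal_def)
  also have "\<dots> = (\<alpha> * 1 + \<beta> * 1\<^sup>2 / 2) - (\<alpha> * 0 + \<beta> * 0\<^sup>2 / 2)"
    unfolding zero_ereal_def one_ereal_def
    by (rule interval_integral_FTC_finite)
       (auto intro!: continuous_intros derivative_eq_intros simp flip: has_real_derivative_iff_has_vector_derivative)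
  finally show ?thesis by simp
qed

lemma sum_seg_vertex_shift:
  fixes h :: "real^3 \<Rightarrow> 'a::comm_monoid_add"
  assumes "polygonal_surface M"
  shows "(\<Sum>j\<in>{1..nseg M}. h (seg_vertex M j 2)) = (\<Sum>j\<in>{1..nseg M}. h (seg_vertex M j 1))"
proof -
  let ?n = "nseg M"
  have "(\<Sum>j\<in>{1..?n}. h (seg_vertex M j 2)) = (\<Sum>j\<in>{1..?n}. h (seg_vertex M (j mod ?n + 1) 1))"
    using seg_vertex_next[OF assms] by (intro sum.cong) auto
  also have "\<dots> = (\<Sum>j\<in>{1..?n}. h (seg_vertex M j 1))"
  proof (intro sum.reindex_bij_witness[of _ "\<lambda>j. if j = 1 then ?n else j - 1" "\<lambda>j. j mod ?n + 1"])
    fix j assume j: "j \<in> {1..?n}"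
    show "(if j mod ?n + 1 = 1 then ?n else j mod ?n + 1 - 1) = j" "j mod ?n + 1 \<in> {1..?n}"
      using j by (cases "j = ?n"; simp)+
  qed auto
  finally show ?thesis .
qed

text \<open>The integrand on a segment with end points \<open>a\<close>, \<open>b\<close> is affine. Up to the telescoping term
  \<open>a \<times> X a - b \<times> X b\<close>, its integral is the increment of the shoelace term of the segment.\<close>

lemma bdry_inner_normal_half:
  assumes X: "X \<in> fe_vec_space M" and M: "polygonal_surface M"
    and M': "polygonal_surface (image_mesh X M)"
  shows "bdry_inner M (bdry_normal_half M X) (\<lambda>x. X x - x)
    = enclosed_area (image_mesh X M) - enclosed_area M"
proof -
  let ?a = "\<lambda>j. seg_vertex M j 1" and ?b = "\<lambda>j. seg_vertex M j 2"
  let ?h = "\<lambda>x. (x \<times> X x) \<bullet> e_z"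
  have seg: "seg_length M j * (LINT t:{0<..<1}|lborel.
        bdry_normal_half M X (?a j + t *\<^sub>R seg_dir M j)
          \<bullet> (X (?a j + t *\<^sub>R seg_dir M j) - (?a j + t *\<^sub>R seg_dir M j)))
      = ((X (?a j) \<times> X (?b j)) \<bullet> e_z - (?a j \<times> ?b j) \<bullet> e_z) / 2 + (?h (?a j) - ?h (?b j)) / 2"
    (is "_ * ?I = _") if j: "j \<in> {1..nseg M}" for j
  proof -
    obtain A c where A: "linear A"
      and Xeq: "\<And>x. x \<in> closed_segment (?a j) (?b j) \<Longrightarrow> X x = A x + c"
      using fe_vec_space_affine_segment[OF X M j] by blast
    let ?d = "seg_dir M j" and ?l = "seg_length M j"
    have l: "?l > 0" "norm ?d = ?l"
      using seg_vertex_distinct[OF M j] by (simp_all add: seg_length_def seg_dir_def)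
    have Ad: "A ?d = X (?b j) - X (?a j)"
      using A by (simp add: Xeq seg_dir_def linear_diff)
    \<comment> \<open>The constant value of the averaged normal on the segment. Its factor
      \<open>1 / ?l\<close> will cancel the length in front of the integral.\<close>
    define n where "n = (1/2) *\<^sub>R (((?d + A ?d) /\<^sub>R ?l) \<times> e_z)"
    have "?I = (LINT t:{0<..<1}|lborel. n \<bullet> (X (?a j) - ?a j) + t * (n \<bullet> (A ?d - ?d)))"
    proof (rule set_lebesgue_integral_cong)
      show "\<forall>t. t \<in> {0<..<1} \<longrightarrow> bdry_normal_half M X (?a j + t *\<^sub>R ?d)
          \<bullet> (X (?a j + t *\<^sub>R ?d) - (?a j + t *\<^sub>R ?d))
        = n \<bullet> (X (?a j) - ?a j) + t * (n \<bullet> (A ?d - ?d))"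
      proof (intro allI impI)
        fix t :: real assume "t \<in> {0<..<1}"
        then have t: "0 < t" "t < 1" by auto
        have "?a j + t *\<^sub>R ?d \<in> closed_segment (?a j) (?b j)"
          using seg_param_in_seg[OF M j t] segment_open_subset_closed unfolding seg_def by blast
        then have X1: "X (?a j + t *\<^sub>R ?d) = X (?a j) + t *\<^sub>R A ?d"
          using A by (simp add: Xeq linear_add linear_scale)
        have "bdry_normal_half M X (?a j + t *\<^sub>R ?d) = n"
          using arc_deriv_affine[OF M j t A, of X c] Xeq
            arc_deriv_affine[OF M j t linear_ident, of "\<lambda>x. x" 0]
          by (simp add: bdry_normal_half_def n_def scaleR_add_right)
        then show "bdry_normal_half M X (?a j + t *\<^sub>R ?d)
          \<bullet> (X (?a j + t *\<^sub>R ?d) - (?a j + t *\<^sub>R ?d))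
        = n \<bullet> (X (?a j) - ?a j) + t * (n \<bullet> (A ?d - ?d))"
          unfolding X1 by (simp add: algebra_simps)
      qed
    qed simp
    also have "\<dots> = n \<bullet> (X (?a j) - ?a j) + n \<bullet> (A ?d - ?d) / 2"
      by (rule set_integral_affine_unit_interval)
    finally have "?l * ?I = (?l *\<^sub>R n) \<bullet> (X (?a j) - ?a j + (1/2) *\<^sub>R (A ?d - ?d))"
      by (simp add: inner_add_right distrib_left)
    moreover have "?l *\<^sub>R n = (1/2) *\<^sub>R ((?d + A ?d) \<times> e_z)"
      using l(1) by (simp add: n_def cross_mult_left)
    ultimately show ?thesis
      unfolding Ad by (simp add: seg_dir_def) (simp add: cross3_simps e_z_def field_simps)
  qed
  have "bdry_inner M (bdry_normal_half M X) (\<lambda>x. X x - x)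
    = (\<Sum>j\<in>{1..nseg M}. ((X (?a j) \<times> X (?b j)) \<bullet> e_z - (?a j \<times> ?b j) \<bullet> e_z) / 2
        + (?h (?a j) - ?h (?b j)) / 2)"
    unfolding bdry_inner_def bdry_integral_def by (intro sum.cong refl seg)
  also have "\<dots> = (\<Sum>j\<in>{1..nseg M}. (X (?a j) \<times> X (?b j)) \<bullet> e_z) / 2
      - (\<Sum>j\<in>{1..nseg M}. (?a j \<times> ?b j) \<bullet> e_z) / 2
      + ((\<Sum>j\<in>{1..nseg M}. ?h (?a j)) - (\<Sum>j\<in>{1..nseg M}. ?h (?b j))) / 2"
    by (simp add: sum.distrib sum_subtractf diff_divide_distrib sum_divide_distrib)
  also have "\<dots> = enclosed_area (image_mesh X M) - enclosed_area M"
    \<comment> \<open>End points and initial points run through the same vertices, so the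
      \<open>?h\<close> terms cancel around the loop.\<close>
    unfolding enclosed_area_eq[OF M] enclosed_area_eq[OF M'] sum_seg_vertex_shift[OF M, of ?h]
    by (simp add: image_mesh_def)
  finally show ?thesis .
qed

section \<open>The anisotropic energy density\<close>

lemma inner_matrix_vector_mult_symmetric:
  fixes A :: "real^3^3"
  assumes "transpose A = A"
  shows "x \<bullet> (A *v y) = y \<bullet> (A *v x)"
  by (metis assms dot_lmul_matrix inner_commute vector_transpose_matrix)

text \<open>Test vectors give the positivity of the leading minors one after the other, each using
  the previous one.\<close>

lemma sym_pos_def_imp_det_pos:
  assumes A: "sym_pos_def A"
  shows "det A > 0"
proof -
  let ?u = "axis 1 1 :: real^3" and ?v = "axis 2 1 :: real^3"
  have tr: "transpose A = A" and pos: "\<And>v. v \<noteq> 0 \<Longrightarrow> v \<bullet> (A *v v) > 0"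
    using A by (auto simp: sym_pos_def_def)
  have s: "A$2$1 = A$1$2"
    using arg_cong[OF tr, of "\<lambda>A. A$1$2"] by (simp add: transpose_def)
  have u0: "?u \<noteq> 0" by (simp add: axis_eq_0_iff)
  have "?u \<bullet> (A *v ?u) = A$1$1"
    by (simp add: inner_axis' matrix_vector_mult_basis column_def)
  then have a: "A$1$1 > 0" using pos[OF u0] by simp
  \<comment> \<open>Chosen so that the first component of \<open>A *v ?p\<close> vanishes; the
    quadratic form then factors into the first two leading minors.\<close>
  let ?p = "vector [A$1$2, - A$1$1, 0] :: real^3"
  have "?p \<noteq> 0" using a by (auto simp: vec_eq_iff forall_3)
  moreover have "?p \<bullet> (A *v ?p) = A$1$1 * (A$1$1 * A$2$2 - A$1$2 * A$1$2)"
    by (simp add: inner_vec_def matrix_vector_mult_def sum_3 s algebra_simps)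
  ultimately have g: "A$1$1 * A$2$2 - A$1$2 * A$1$2 > 0"
    using pos[of ?p] a by (simp add: zero_less_mult_iff)
  let ?c = "(A *v ?u) \<times> (A *v ?v)"
  have c: "?c $ 3 = A$1$1 * A$2$2 - A$1$2 * A$1$2"
    by (simp add: cross_components matrix_vector_mult_basis column_def s)
  \<comment> \<open>The cofactor identity: the transpose of \<open>A\<close> maps
    \<open>(A *v u) \<times> (A *v v)\<close> to \<open>det A\<close> times
    \<open>u \<times> v\<close>.\<close>
  have "A *v ?c = det A *\<^sub>R (?u \<times> ?v)"
    using cross_matrix_mult[of A ?u ?v] tr by simp
  then have "?c \<bullet> (A *v ?c) = det A * ?c $ 3"
    by (simp add: cross_basis inner_axis)
  moreover have "?c \<noteq> 0" using c g by auto
  ultimately show ?thesis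
    using pos[of ?c] g c by (simp add: zero_less_mult_iff)
qed

lemma mult_aniso_mat:
  assumes "sym_pos_def A"
  shows "A *v (aniso_mat A *v x) = sqrt (det A) *\<^sub>R x"
proof -
  have "invertible A"
    using sym_pos_def_imp_det_pos[OF assms] by (simp add: invertible_det_nz)
  then have "A ** matrix_inv A = mat 1"
    unfolding invertible_def matrix_inv_def by (rule someI2_ex) blast
  then have "A *v (matrix_inv A *v x) = x"
    by (simp add: matrix_vector_mul_assoc)
  then show ?thesis
    by (simp add: aniso_mat_def matrix_vector_mult_scaleR flip: scaleR_matrix_vector_assoc)
qed

lemma aniso_mat_sym_pos:
  assumes A: "sym_pos_def A"
  shows "x \<bullet> (aniso_mat A *v y) = y \<bullet> (aniso_mat A *v x)"
    and "x \<noteq> 0 \<Longrightarrow> x \<bullet> (aniso_mat A *v x) > 0"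
    and "x \<bullet> (aniso_mat A *v x) \<ge> 0"
proof -
  let ?B = "aniso_mat A" and ?s = "sqrt (det A)"
  have s: "?s > 0" using sym_pos_def_imp_det_pos[OF A] by simp
  \<comment> \<open>Writing \<open>x\<close> as a multiple of \<open>A *v (?B *v x)\<close> lets
    \<open>?B\<close> inherit symmetry and positivity from \<open>A\<close>.\<close>
  have eq: "?s * (x \<bullet> (?B *v y)) = (?B *v y) \<bullet> (A *v (?B *v x))" for x y
    by (simp add: mult_aniso_mat[OF A] inner_commute)
  have "?s * (x \<bullet> (?B *v y)) = ?s * (y \<bullet> (?B *v x))"
    unfolding eq using A by (simp add: inner_matrix_vector_mult_symmetric sym_pos_def_def)
  then show "x \<bullet> (?B *v y) = y \<bullet> (?B *v x)" using s by simp
  show pos: "x \<bullet> (?B *v x) > 0" if "x \<noteq> 0"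
  proof -
    have "?B *v x \<noteq> 0"
      using mult_aniso_mat[OF A, of x] s that by auto
    then have "?s * (x \<bullet> (?B *v x)) > 0"
      unfolding eq using A by (simp add: sym_pos_def_def)
    then show ?thesis using s by (simp add: zero_less_mult_iff)
  qed
  show "x \<bullet> (?B *v x) \<ge> 0"
    using pos by (cases "x = 0") auto
qed

text \<open>The scaling in \<^const>\<open>aniso_mat\<close> is chosen so that \<open>A\<close> is the cofactor matrix of
  \<open>aniso_mat A\<close>.\<close>

lemma cross_aniso_mat:
  assumes A: "sym_pos_def A"
  shows "(aniso_mat A *v u) \<times> (aniso_mat A *v v) = A *v (u \<times> v)"
proof -
  let ?B = "aniso_mat A" and ?d = "det A"
  have d: "?d > 0" by (rule sym_pos_def_imp_det_pos[OF A])
  have tr: "transpose ?B = ?B"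
  proof -
    have "(transpose ?B *v x) \<bullet> y = (?B *v x) \<bullet> y" for x y
      by (metis aniso_mat_sym_pos(1)[OF A] dot_lmul_matrix inner_commute vector_transpose_matrix
          transpose_transpose)
    then have "transpose ?B *v x = ?B *v x" for x
      by (metis vector_eq_rdot)
    then show ?thesis by (metis matrix_eq)
  qed
  have "A ** ?B = sqrt ?d *\<^sub>R mat 1"
    unfolding matrix_eq
    by (simp add: mult_aniso_mat[OF A] flip: matrix_vector_mul_assoc scaleR_matrix_vector_assoc)
  then have "?d * det ?B = det (sqrt ?d *\<^sub>R mat 1 :: real^3^3)"
    by (metis det_mul)
  also have "\<dots> = sqrt ?d * sqrt ?d * sqrt ?d"
    by (simp add: det_3 mat_def)
  finally have dB: "det ?B = sqrt ?d" using d by simp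
  have "?B *v ((?B *v u) \<times> (?B *v v)) = sqrt ?d *\<^sub>R (u \<times> v)"
    using cross_matrix_mult[of ?B u v] by (simp add: tr dB)
  then have "sqrt ?d *\<^sub>R ((?B *v u) \<times> (?B *v v)) = A *v (sqrt ?d *\<^sub>R (u \<times> v))"
    using mult_aniso_mat[OF A] by metis
  then show ?thesis using d by (simp add: matrix_vector_mult_scaleR)
qed

text \<open>By the cofactor property the left side is a dot product of two cross products, so
  \<open>dot_cross\<close> gives a Gram determinant.\<close>

lemma gram_aniso_mat:
  assumes "sym_pos_def A"
  shows "(u \<times> v) \<bullet> (A *v (u \<times> v))
    = (u \<bullet> (aniso_mat A *v u)) * (v \<bullet> (aniso_mat A *v v)) - (u \<bullet> (aniso_mat A *v v))\<^sup>2"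
  unfolding cross_aniso_mat[OF assms, symmetric]
  using aniso_mat_sym_pos(1)[OF assms, of v u] by (simp add: dot_cross power2_eq_square)

lemma gamma1_scaleR: "gamma1 A (c *\<^sub>R v) = \<bar>c\<bar> * gamma1 A v"
proof -
  have "(c *\<^sub>R v) \<bullet> (A *v (c *\<^sub>R v)) = c\<^sup>2 * (v \<bullet> (A *v v))"
    by (simp add: matrix_vector_mult_scaleR power2_eq_square)
  then show ?thesis by (simp add: gamma1_def real_sqrt_mult)
qed

text \<open>The squared off-diagonal Gram entry is dropped before AM-GM, so equality holds for
  orthogonal vectors of equal length with respect to \<open>aniso_mat A\<close>.\<close>

lemma gamma1_cross_le:
  assumes A: "sym_pos_def A"
  shows "gamma1 A (u \<times> v) \<le> (u \<bullet> (aniso_mat A *v u) + v \<bullet> (aniso_mat A *v v)) / 2"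
proof -
  let ?p = "u \<bullet> (aniso_mat A *v u)" and ?q = "v \<bullet> (aniso_mat A *v v)"
  have "gamma1 A (u \<times> v) \<le> sqrt (?p * ?q)"
    unfolding gamma1_def gram_aniso_mat[OF A] by (rule real_sqrt_le_mono) simp
  also have "\<dots> \<le> (?p + ?q) / 2"
    by (intro arith_geo_mean_sqrt aniso_mat_sym_pos(3)[OF A])
  finally show ?thesis .
qed

section \<open>Bases of the tangent plane and the energy of an affine map\<close>

lemma orthogonal_complement_span:
  fixes n t\<^sub>1 t\<^sub>2 :: "real^3"
  assumes "n \<noteq> 0" "n \<bullet> t\<^sub>1 = 0" "n \<bullet> t\<^sub>2 = 0" "t\<^sub>1 \<times> t\<^sub>2 \<noteq> 0"
  shows "span {t\<^sub>1, t\<^sub>2} = {v. n \<bullet> v = 0}"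
proof
  have "subspace {v. n \<bullet> v = 0}" by (rule subspace_hyperplane)
  then show "span {t\<^sub>1, t\<^sub>2} \<subseteq> {v. n \<bullet> v = 0}"
    using assms by (intro span_minimal) auto
  show "{v. n \<bullet> v = 0} \<subseteq> span {t\<^sub>1, t\<^sub>2}"
  proof safe
    fix v assume v: "n \<bullet> v = 0"
    let ?c = "t\<^sub>1 \<times> t\<^sub>2"
    have "n \<times> ?c = 0"
      using assms by (simp add: Lagrange)
    then have "(n \<bullet> n) *\<^sub>R ?c = (n \<bullet> ?c) *\<^sub>R n"
      using Lagrange[of n n ?c] by simp
    then have "(n \<bullet> n) * (?c \<bullet> v) = 0"
      using v by (metis inner_scaleR_left mult_zero_right)
    then have cv: "?c \<bullet> v = 0" using assms by simp
    have "v = inverse (?c \<bullet> ?c) *\<^sub>R ((?c \<bullet> ?c) *\<^sub>R v)"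
      using assms(4) by simp
    \<comment> \<open>Cramer's rule in the basis formed by the two vectors and \<open>?c\<close>.
      The last coefficient vanishes because \<open>?c\<close> is parallel to
      \<open>n\<close>.\<close>
    also have "(?c \<bullet> ?c) *\<^sub>R v = ((v \<times> t\<^sub>2) \<bullet> ?c) *\<^sub>R t\<^sub>1 + ((t\<^sub>1 \<times> v) \<bullet> ?c) *\<^sub>R t\<^sub>2 + (?c \<bullet> v) *\<^sub>R ?c"
      by (simp add: cross3_simps forall_3)
    also have "\<dots> = ((v \<times> t\<^sub>2) \<bullet> ?c) *\<^sub>R t\<^sub>1 + ((t\<^sub>1 \<times> v) \<bullet> ?c) *\<^sub>R t\<^sub>2"
      by (simp add: cv)
    finally have v: "v = inverse (?c \<bullet> ?c) *\<^sub>R \<dots>" .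
    have "((v \<times> t\<^sub>2) \<bullet> ?c) *\<^sub>R t\<^sub>1 + ((t\<^sub>1 \<times> v) \<bullet> ?c) *\<^sub>R t\<^sub>2 \<in> span {t\<^sub>1, t\<^sub>2}"
      by (intro span_add span_scale span_base) auto
    then show "v \<in> span {t\<^sub>1, t\<^sub>2}"
      by (subst v) (rule span_scale)
  qed
qed

text \<open>Gram-Schmidt with respect to \<open>aniso_mat A\<close> on two tangent vectors.
  Existence gives meaning to the \<open>SOME\<close> in \<open>aniso_prod\<close>.\<close>

lemma aniso_basis_exists:
  assumes A: "sym_pos_def A" and n: "n \<noteq> 0"
  shows "\<exists>t. is_aniso_basis (aniso_mat A) n t"
proof -
  let ?B = "aniso_mat A"
  obtain e where e: "n \<times> e \<noteq> 0"
    using cross_basis_nonzero[OF n] by blast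
  define u v where "u = n \<times> e" and "v = n \<times> u"
  have uv: "n \<bullet> u = 0" "n \<bullet> v = 0" "u \<noteq> 0"
    using e by (simp_all add: u_def v_def dot_cross_self)
  have "u \<times> v = (u \<bullet> u) *\<^sub>R n"
    using uv(1) by (simp add: v_def Lagrange inner_commute)
  then have uxv: "u \<times> v \<noteq> 0" using uv n by simp
  define t\<^sub>1 where "t\<^sub>1 = u /\<^sub>R sqrt (u \<bullet> (?B *v u))"
  define w where "w = v - (t\<^sub>1 \<bullet> (?B *v v)) *\<^sub>R t\<^sub>1"
  define t\<^sub>2 where "t\<^sub>2 = w /\<^sub>R sqrt (w \<bullet> (?B *v w))"
  have pos: "u \<bullet> (?B *v u) > 0" using aniso_mat_sym_pos(2)[OF A uv(3)] .
  have t1: "t\<^sub>1 \<bullet> (?B *v t\<^sub>1) = 1"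
    using pos by (simp add: t\<^sub>1_def matrix_vector_mult_scaleR field_simps)
  have "w \<noteq> 0"
  proof
    assume "w = 0"
    then have "v = ((t\<^sub>1 \<bullet> (?B *v v)) / sqrt (u \<bullet> (?B *v u))) *\<^sub>R u"
      by (simp add: w_def t\<^sub>1_def divide_inverse)
    then show False using uxv by (metis cross_mult_right cross_refl scaleR_zero_right)
  qed
  then have posw: "w \<bullet> (?B *v w) > 0" using aniso_mat_sym_pos(2)[OF A] by blast
  have t2: "t\<^sub>2 \<bullet> (?B *v t\<^sub>2) = 1"
    using posw by (simp add: t\<^sub>2_def matrix_vector_mult_scaleR field_simps)
  have "t\<^sub>1 \<bullet> (?B *v w) = 0"
    by (simp add: w_def matrix_vector_mult_diff_distrib inner_diff_right matrix_vector_mult_scaleR t1)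
  then have t12: "t\<^sub>1 \<bullet> (?B *v t\<^sub>2) = 0"
    by (simp add: t\<^sub>2_def matrix_vector_mult_scaleR)
  then have t21: "t\<^sub>2 \<bullet> (?B *v t\<^sub>1) = 0" using aniso_mat_sym_pos(1)[OF A] by metis
  \<comment> \<open>Orthonormality makes the Gram determinant 1, which yields linear
    independence.\<close>
  have "(t\<^sub>1 \<times> t\<^sub>2) \<bullet> (A *v (t\<^sub>1 \<times> t\<^sub>2)) = 1"
    by (simp add: gram_aniso_mat[OF A] t1 t2 t12)
  then have "t\<^sub>1 \<times> t\<^sub>2 \<noteq> 0" by auto
  moreover have "n \<bullet> t\<^sub>1 = 0" "n \<bullet> t\<^sub>2 = 0"
    using uv by (simp_all add: t\<^sub>1_def t\<^sub>2_def w_def inner_diff_right)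
  ultimately have "span {t\<^sub>1, t\<^sub>2} = {v. n \<bullet> v = 0}"
    using n by (intro orthogonal_complement_span)
  then have "is_aniso_basis ?B n (\<lambda>i. if i = 1 then t\<^sub>1 else t\<^sub>2)"
    by (simp add: is_aniso_basis_def t1 t2 t12 t21 insert_commute)
  then show ?thesis by blast
qed

text \<open>With \<open>e\<^sub>i\<close> expanded in the orthonormal basis, \<open>e\<^sub>1 \<times> e\<^sub>2\<close> and \<open>P e\<^sub>1 \<times> P e\<^sub>2\<close> are the same
  multiple of \<open>t\<^sub>1 \<times> t\<^sub>2\<close> and \<open>P t\<^sub>1 \<times> P t\<^sub>2\<close>, and \<open>gamma1 A (t\<^sub>1 \<times> t\<^sub>2) = 1\<close>.\<close>

lemma aniso_energy_increment:
  assumes A: "sym_pos_def A" and P: "linear P"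
    and e: "e\<^sub>1 \<times> e\<^sub>2 \<noteq> 0"
    and n: "n = (e\<^sub>1 \<times> e\<^sub>2) /\<^sub>R norm (e\<^sub>1 \<times> e\<^sub>2)"
    and t: "is_aniso_basis (aniso_mat A) n t"
  shows "gamma1 A (P e\<^sub>1 \<times> P e\<^sub>2) - gamma1 A (e\<^sub>1 \<times> e\<^sub>2)
    \<le> norm (e\<^sub>1 \<times> e\<^sub>2) * (gamma1 A n * (\<Sum>i\<in>{1, 2}. P (t i) \<bullet> (aniso_mat A *v (P (t i) - t i))))"
proof -
  let ?B = "aniso_mat A" and ?c = "e\<^sub>1 \<times> e\<^sub>2"
  have span: "span {t 1, t 2} = {v. n \<bullet> v = 0}"
    and o: "t 1 \<bullet> (?B *v t 1) = 1" "t 2 \<bullet> (?B *v t 2) = 1" "t 1 \<bullet> (?B *v t 2) = 0"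
    using t by (auto simp: is_aniso_basis_def)
  have "e\<^sub>1 \<in> span {t 1, t 2}" "e\<^sub>2 \<in> span {t 1, t 2}"
    unfolding span by (simp_all add: n dot_cross_self)
  then obtain a\<^sub>1 b\<^sub>1 a\<^sub>2 b\<^sub>2 where e1: "e\<^sub>1 = a\<^sub>1 *\<^sub>R t 1 + b\<^sub>1 *\<^sub>R t 2" and e2: "e\<^sub>2 = a\<^sub>2 *\<^sub>R t 1 + b\<^sub>2 *\<^sub>R t 2"
    unfolding span_insert by (fastforce simp: algebra_simps)
  define k where "k = a\<^sub>1 * b\<^sub>2 - a\<^sub>2 * b\<^sub>1"
  have cross: "(a\<^sub>1 *\<^sub>R x + b\<^sub>1 *\<^sub>R y) \<times> (a\<^sub>2 *\<^sub>R x + b\<^sub>2 *\<^sub>R y) = k *\<^sub>R (x \<times> y)" for x y :: "real^3"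
    by (simp add: k_def cross3_simps forall_3)
  have c: "?c = k *\<^sub>R (t 1 \<times> t 2)"
    unfolding e1 e2 cross ..
  have Pc: "P e\<^sub>1 \<times> P e\<^sub>2 = k *\<^sub>R (P (t 1) \<times> P (t 2))"
    using P by (simp add: e1 e2 linear_add linear_scale cross)
  have "gamma1 A (t 1 \<times> t 2) = 1"
    by (simp add: gamma1_def gram_aniso_mat[OF A] o del: One_nat_def)
  then have gc: "gamma1 A ?c = \<bar>k\<bar>"
    by (simp add: c gamma1_scaleR)
  have gn: "norm ?c * gamma1 A n = \<bar>k\<bar>"
    using e by (simp add: n gamma1_scaleR gc)
  \<comment> \<open>The difference of the two sides is half the quadratic form at
    \<open>p - q\<close>.\<close>
  have young: "(p \<bullet> (?B *v p) - q \<bullet> (?B *v q)) / 2 \<le> p \<bullet> (?B *v (p - q))" for p q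
    using aniso_mat_sym_pos(3)[OF A, of "p - q"] aniso_mat_sym_pos(1)[OF A, of p q]
    by (simp add: matrix_vector_mult_diff_distrib inner_diff_left inner_diff_right)
  \<comment> \<open>The subtracted 1 is half the sum of \<open>t i \<bullet> (?B *v t i)\<close>
    over the two basis vectors.\<close>
  have "gamma1 A (P (t 1) \<times> P (t 2)) - 1
    \<le> (\<Sum>i\<in>{1, 2}. (P (t i) \<bullet> (?B *v P (t i)) - t i \<bullet> (?B *v t i)) / 2)"
    using gamma1_cross_le[OF A, of "P (t 1)" "P (t 2)"] by (simp add: o field_simps del: One_nat_def)
  also have "\<dots> \<le> (\<Sum>i\<in>{1, 2}. P (t i) \<bullet> (?B *v (P (t i) - t i)))"
    by (intro sum_mono young)
  finally have "\<bar>k\<bar> * (gamma1 A (P (t 1) \<times> P (t 2)) - 1)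
    \<le> \<bar>k\<bar> * (\<Sum>i\<in>{1, 2}. P (t i) \<bullet> (?B *v (P (t i) - t i)))"
    by (intro mult_left_mono) auto
  then show ?thesis
    unfolding Pc gamma1_scaleR gc mult.assoc[symmetric] gn by (simp add: right_diff_distrib)
qed

section \<open>Fields on the triangles\<close>

lemma tri_vertices_eq: "tri_vertices M j = {tri_vertex M j 1, tri_vertex M j 2, tri_vertex M j 3}"
  by (simp add: tri_vertices_def)

lemma tri_cross_nonzero:
  assumes "polygonal_surface M" "j \<in> {1..ntri M}"
  shows "tri_cross M j \<noteq> 0"
proof -
  have "\<not> collinear {tri_vertex M j 2, tri_vertex M j 1, tri_vertex M j 3}"
    using assms by (simp add: polygonal_surface_def tri_vertices_eq insert_commute)
  then show "tri_cross M j \<noteq> 0"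
    by (simp add: collinear_3[of "tri_vertex M j 2"] tri_cross_def cross_eq_0)
qed

lemma tri_of_eq:
  assumes "polygonal_surface M" "j \<in> {1..ntri M}" "x \<in> tri M j"
  shows "tri_of M x = j"
proof -
  have "i = j" if "i \<in> {1..ntri M}" "x \<in> tri M i" for i
    using assms that unfolding polygonal_surface_def by blast
  then show ?thesis
    unfolding tri_of_def using assms(2,3) by (intro the_equality) blast+
qed

lemma surf_normal_eq:
  assumes "polygonal_surface M" "j \<in> {1..ntri M}" "x \<in> tri M j"
  shows "surf_normal M x = tri_normal M j"
  by (simp add: surf_normal_def tri_of_eq[OF assms])

lemma tri_param_in_tri:
  assumes M: "polygonal_surface M" and j: "j \<in> {1..ntri M}" and z: "z \<in> unit_triangle"
  shows "tri_param M j z \<in> tri M j"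
proof -
  let ?p = "tri_vertex M j 1" and ?q = "tri_vertex M j 2" and ?r = "tri_vertex M j 3"
  obtain s t where st: "z = (s, t)" "0 < s" "0 < t" "s + t < 1"
    using z by (auto simp: unit_triangle_def)
  have "?q - ?p \<noteq> 0" "?r - ?p \<noteq> 0" "?q - ?p \<noteq> ?r - ?p"
    using tri_cross_nonzero[OF M j] unfolding tri_cross_def by (metis cross_zero_left cross_zero_right cross_refl)+
  then have d: "?p \<noteq> ?q" "?p \<noteq> ?r" "?q \<noteq> ?r" by auto
  \<comment> \<open>Barycentric coordinates as a function of the vertex, well defined because the
    three vertices are distinct.\<close>
  let ?u = "\<lambda>x. if x = ?p then 1 - s - t else if x = ?q then s else t"
  have "(\<forall>x\<in>{?p, ?q, ?r}. 0 < ?u x) \<and> sum ?u {?p, ?q, ?r} = 1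
      \<and> (\<Sum>x\<in>{?p, ?q, ?r}. ?u x *\<^sub>R x) = tri_param M j z"
    using st d by (auto simp: tri_param_def algebra_simps)
  then show ?thesis
    unfolding tri_def tri_vertices_eq
    by (intro subsetD[OF explicit_subset_rel_interior_convex_hull_minimal] CollectI exI[of _ ?u])
       auto
qed

lemma measure_unit_triangle:
  "unit_triangle \<in> sets lborel" "emeasure lborel unit_triangle < \<infinity>"
  "measure lborel unit_triangle = 1 / 2"
proof -
  let ?T = "convex hull (insert 0 Basis) :: (real \<times> real) set"
  have eq: "unit_triangle = interior ?T"
    unfolding interior_std_simplex unit_triangle_def by (auto simp: Basis_prod_def)
  have "open unit_triangle" unfolding eq by (rule open_interior)
  then show meas: "unit_triangle \<in> sets lborel" by simp
  have bd: "bounded ?T" by (simp add: finite_imp_bounded_convex_hull)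
  then have "bounded unit_triangle" unfolding eq by (rule bounded_interior)
  then show "emeasure lborel unit_triangle < \<infinity>" by (rule emeasure_bounded_finite)
  have "measure lborel unit_triangle = measure lebesgue (interior ?T)"
    using meas by (simp add: eq measure_completion)
  also have "\<dots> = measure lebesgue ?T"
    using bd by (intro measure_interior negligible_convex_frontier) auto
  also have "\<dots> = measure lborel ?T"
    by (intro measure_completion) (simp add: borel_closed compact_imp_closed finite_imp_compact_convex_hull)
  also have "\<dots> = 1 / 2"
    by (simp add: content_std_simplex)
  finally show "measure lborel unit_triangle = 1 / 2" .
qed

lemma surf_integral_piecewise_constant:
  assumes M: "polygonal_surface M"
    and f: "\<And>j x. j \<in> {1..ntri M} \<Longrightarrow> x \<in> tri M j \<Longrightarrow> f x = k j"
  shows "surf_integral M f = (\<Sum>j\<in>{1..ntri M}. norm (tri_cross M j) * k j) / 2"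
proof -
  have "(LINT z:unit_triangle|lborel. f (tri_param M j z)) = k j / 2" if j: "j \<in> {1..ntri M}" for j
  proof -
    have "(LINT z:unit_triangle|lborel. f (tri_param M j z)) = (LINT z:unit_triangle|lborel. k j)"
      using f[OF j] tri_param_in_tri[OF M j] measure_unit_triangle(1)
      by (intro set_lebesgue_integral_cong) auto
    also have "\<dots> = k j / 2"
      using measure_unit_triangle by (subst set_integral_const) auto
    finally show ?thesis .
  qed
  then show ?thesis
    unfolding surf_integral_def sum_divide_distrib by (intro sum.cong) auto
qed

lemma tri_open_in_direction:
  assumes x: "x \<in> tri M j" and pq: "p \<in> tri_vertices M j" "q \<in> tri_vertices M j"
  shows "\<exists>e>0. \<forall>s. \<bar>s\<bar> < e \<longrightarrow> x + s *\<^sub>R (p - q) \<in> tri M j"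
proof -
  let ?S = "convex hull tri_vertices M j"
  obtain e where e: "e > 0" "ball x e \<inter> affine hull (tri M j) \<subseteq> tri M j"
  proof -
    have "rel_open (tri M j)"
      unfolding tri_def by (simp add: rel_interior_rel_open)
    then have "x \<in> rel_interior (tri M j)" using x by (simp add: rel_open_def)
    then show ?thesis using that unfolding mem_rel_interior_ball by blast
  qed
  have aff: "affine hull (tri M j) = affine hull (tri_vertices M j)"
    unfolding tri_def by (simp add: affine_hull_convex_hull rel_interior_same_affine_hull)
  \<comment> \<open>The summand 1 keeps the denominator positive when \<open>p = q\<close>.\<close>
  define d where "d = e / (norm (p - q) + 1)"
  have n: "norm (p - q) + 1 > 0" by (simp add: add_nonneg_pos)
  have d: "d > 0" using e n by (simp add: d_def)
  have "x + s *\<^sub>R (p - q) \<in> tri M j" if s: "\<bar>s\<bar> < d" for s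
  proof -
    have "x \<in> affine hull (tri M j)" "p \<in> affine hull (tri M j)" "q \<in> affine hull (tri M j)"
      using x pq by (simp_all add: hull_inc) (simp_all add: aff hull_inc)
    then have "x + s *\<^sub>R (p - q) \<in> affine hull (tri M j)"
      by (intro mem_affine_3_minus) auto
    moreover have "\<bar>s\<bar> * norm (p - q) < e"
    proof -
      have "\<bar>s\<bar> * norm (p - q) \<le> \<bar>s\<bar> * (norm (p - q) + 1)" by (simp add: distrib_left)
      also have "\<dots> < d * (norm (p - q) + 1)"
        using s n by (intro mult_strict_right_mono)
      also have "\<dots> = e" using n by (simp add: d_def)
      finally show ?thesis .
    qed
    then have "x + s *\<^sub>R (p - q) \<in> ball x e" by (simp add: dist_norm)
    ultimately show ?thesis using e(2) by blast
  qed
  then show ?thesis using d by blast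
qed

text \<open>Gradients of two differentiable extensions agree along the edges, so they differ by a
  multiple of the normal, which the projection removes. This makes the description in
  \<open>surf_grad\<close> unique.\<close>

lemma surf_grad_affine:
  assumes M: "polygonal_surface M" and j: "j \<in> {1..ntri M}" and x: "x \<in> tri M j"
    and f: "\<And>y. y \<in> tri M j \<Longrightarrow> f y = a \<bullet> y + b"
  shows "surf_grad M f x = a - (tri_normal M j \<bullet> a) *\<^sub>R tri_normal M j"
proof -
  let ?n = "tri_normal M j" and ?c = "tri_cross M j"
  let ?p = "tri_vertex M j 1" and ?q = "tri_vertex M j 2" and ?r = "tri_vertex M j 3"
  have uniq: "g - (?n \<bullet> g) *\<^sub>R ?n = a - (?n \<bullet> a) *\<^sub>R ?n"
    if F: "\<forall>y\<in>tri M j. F y = f y" and g: "GDERIV F x :> g" for F g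
  proof -
    have orth: "(g - a) \<bullet> (v - w) = 0"
      if vw: "v \<in> tri_vertices M j" "w \<in> tri_vertices M j" for v w
    proof -
      obtain e where e: "e > 0" "\<And>s. \<bar>s\<bar> < e \<Longrightarrow> x + s *\<^sub>R (v - w) \<in> tri M j"
        using tri_open_in_direction[OF x vw] by blast
      have "((\<lambda>s. F (x + s *\<^sub>R (v - w))) has_derivative (\<lambda>s. (s *\<^sub>R (v - w)) \<bullet> g)) (at 0)"
        using g unfolding gderiv_def
        by (intro has_derivative_compose[where g = F and f = "\<lambda>s. x + s *\<^sub>R (v - w)"])
           (auto intro!: derivative_eq_intros)
      then have "((\<lambda>s. a \<bullet> (x + s *\<^sub>R (v - w)) + b) has_derivative (\<lambda>s. (s *\<^sub>R (v - w)) \<bullet> g)) (at 0)"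
        by (rule has_derivative_transform_within_open[OF _ open_ball[of 0 e]])
           (use e F f in \<open>auto simp: dist_norm\<close>)
      moreover have "((\<lambda>s. a \<bullet> (x + s *\<^sub>R (v - w)) + b) has_derivative (\<lambda>s. a \<bullet> (s *\<^sub>R (v - w)))) (at 0)"
        by (auto intro!: derivative_eq_intros)
      ultimately have "(\<lambda>s. (s *\<^sub>R (v - w)) \<bullet> g) = (\<lambda>s. a \<bullet> (s *\<^sub>R (v - w)))"
        by (rule has_derivative_unique)
      from fun_cong[OF this, of 1] show ?thesis
        by (simp add: inner_diff_left inner_commute)
    qed
    let ?w = "g - a"
    have "?w \<times> ?c = 0"
      using orth[of ?q ?p] orth[of ?r ?p] by (simp add: tri_cross_def Lagrange tri_vertices_eq)
    then have "(?c \<bullet> ?c) *\<^sub>R ?w = (?c \<bullet> ?w) *\<^sub>R ?c"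
      using Lagrange[of ?c ?w ?c] by simp
    then have "inverse (?c \<bullet> ?c) *\<^sub>R (?c \<bullet> ?c) *\<^sub>R ?w = inverse (?c \<bullet> ?c) *\<^sub>R (?c \<bullet> ?w) *\<^sub>R ?c"
      by (rule arg_cong)
    then have "?w = (inverse (?c \<bullet> ?c) * (?c \<bullet> ?w)) *\<^sub>R ?c"
      using tri_cross_nonzero[OF M j] by simp
    also have "\<dots> = (?n \<bullet> ?w) *\<^sub>R ?n"
      by (simp add: tri_normal_def dot_square_norm power2_eq_square divide_inverse)
    finally have "?w = (?n \<bullet> ?w) *\<^sub>R ?n" .
    then show ?thesis by (simp add: inner_diff_right scaleR_diff_left algebra_simps)
  qed
  have deriv: "GDERIV (\<lambda>y. a \<bullet> y + b) x :> a"
    unfolding gderiv_def by (auto intro!: derivative_eq_intros simp: inner_commute)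
  show ?thesis
    unfolding surf_grad_def surf_normal_eq[OF M j x] tri_of_eq[OF M j x]
  proof (rule the_equality)
    show "\<exists>F g. (\<forall>y\<in>tri M j. F y = f y) \<and> GDERIV F x :> g \<and>
        a - (?n \<bullet> a) *\<^sub>R ?n = g - (?n \<bullet> g) *\<^sub>R ?n"
      using f deriv by (intro exI[of _ "\<lambda>y. a \<bullet> y + b"] exI[of _ a]) simp
  qed (use uniq in blast)
qed

lemma dir_deriv_affine:
  assumes M: "polygonal_surface M" and j: "j \<in> {1..ntri M}" and x: "x \<in> tri M j"
    and P: "linear P" and u: "\<And>y. y \<in> tri M j \<Longrightarrow> u y = P y + c"
    and t: "tri_normal M j \<bullet> t = 0"
  shows "dir_deriv M t u x = P t"
proof -
  have "t \<bullet> surf_grad M (\<lambda>y. u y $ k) x = P t $ k" for k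
  proof -
    \<comment> \<open>The \<open>k\<close>-th row of \<open>P\<close>, the gradient of the
      \<open>k\<close>-th component.\<close>
    let ?a = "adjoint P (axis k 1)"
    have a: "?a \<bullet> y = P y $ k" for y
      using adjoint_works[OF P, of y "axis k 1"] by (simp add: inner_axis inner_commute)
    have "surf_grad M (\<lambda>y. u y $ k) x = ?a - (tri_normal M j \<bullet> ?a) *\<^sub>R tri_normal M j"
      by (rule surf_grad_affine[OF M j x, where b = "c $ k"]) (simp add: u a)
    then show ?thesis using t a[of t] by (simp add: inner_diff_right inner_commute)
  qed
  then show ?thesis by (simp add: dir_deriv_def vec_eq_iff)
qed

section \<open>Vertex limits and the displacement as a test function\<close>

lemma tri_subset_surface: "j \<in> {1..ntri M} \<Longrightarrow> tri M j \<subseteq> surface M"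
  using closure_subset by (fastforce simp: surface_def)

lemma tri_vertex_in_surface: "j \<in> {1..ntri M} \<Longrightarrow> k \<in> {1, 2, 3} \<Longrightarrow> tri_vertex M j k \<in> surface M"
  unfolding surface_def closure_tri tri_vertices_def by (force intro!: hull_inc)

text \<open>Makes the \<open>Lim\<close> in \<open>vertex_limit\<close> unique. A connected set with
  more than one point is perfect, and a set has the same limit points as its closure.\<close>

lemma tri_vertex_islimpt:
  assumes M: "polygonal_surface M" and j: "j \<in> {1..ntri M}" and k: "k \<in> {1, 2, 3}"
  shows "tri_vertex M j k islimpt tri M j"
proof -
  let ?S = "convex hull tri_vertices M j"
  have v: "tri_vertices M j \<subseteq> ?S" by (rule hull_subset)
  have "\<not> collinear (tri_vertices M j)"
    using M j by (simp add: polygonal_surface_def)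
  then have "?S \<noteq> {x}" for x
    using v collinear_subset[of "{x}" "tri_vertices M j"] by auto
  moreover have "tri_vertex M j k \<in> ?S"
    using k v by (auto simp: tri_vertices_def)
  moreover have "connected ?S" by (simp add: convex_connected)
  ultimately have "tri_vertex M j k islimpt ?S"
    by (intro connected_imp_perfect) auto
  then show ?thesis by (simp add: limpt_of_closure flip: closure_tri)
qed

lemma fe_vec_space_continuous_on:
  assumes "X \<in> fe_vec_space M"
  shows "continuous_on (surface M) X"
proof -
  have "continuous_on (surface M) (\<lambda>x. X x $ k)" for k
    using assms exhaust_3[of k] by (auto simp: fe_vec_space_def fe_space0_def fe_space_def)
  then show ?thesis
    using continuous_on_vec_lambda[of "surface M" "\<lambda>k x. X x $ k"] by simp
qed

text \<open>Turns the lumped product of the first equation of the scheme into that of the second.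
  Only the limits of the continuous displacement are evaluated; those of \<open>g\<close>, in the
  application the discontinuous \<open>\<mu>\<close> times normal, are carried along.\<close>

lemma lumped_inner_displacement:
  fixes g :: "real^3 \<Rightarrow> real^3"
  assumes M: "polygonal_surface M" and X: "X \<in> fe_vec_space M"
  shows "lumped_inner M (\<lambda>x. (X x - x) /\<^sub>R \<tau>) g = lumped_inner M g (\<lambda>x. X x - x) / \<tau>"
proof -
  have lim: "vertex_limit M (\<lambda>x. c *\<^sub>R (X x - x)) j k = c *\<^sub>R (X (tri_vertex M j k) - tri_vertex M j k)"
    if jk: "j \<in> {1..ntri M}" "k \<in> {1, 2, 3}" for c j k
  proof -
    have "((\<lambda>x. c *\<^sub>R (X x - x)) \<longlongrightarrow> c *\<^sub>R (X (tri_vertex M j k) - tri_vertex M j k))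
        (at (tri_vertex M j k) within surface M)"
      using fe_vec_space_continuous_on[OF X] tri_vertex_in_surface[OF jk]
      by (auto simp: continuous_on_def intro!: tendsto_intros)
    then have "((\<lambda>x. c *\<^sub>R (X x - x)) \<longlongrightarrow> c *\<^sub>R (X (tri_vertex M j k) - tri_vertex M j k))
        (at (tri_vertex M j k) within tri M j)"
      using tri_subset_surface[OF jk(1)] by (rule tendsto_within_subset)
    then show ?thesis
      unfolding vertex_limit_def using tri_vertex_islimpt[OF M jk]
      by (intro tendsto_Lim) (auto simp: trivial_limit_within)
  qed
  have "tri_area M j * (vertex_limit M (\<lambda>x. (X x - x) /\<^sub>R \<tau>) j k \<bullet> vertex_limit M g j k)
      = tri_area M j * (vertex_limit M g j k \<bullet> vertex_limit M (\<lambda>x. X x - x) j k) / \<tau>"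
    if jk: "j \<in> {1..ntri M}" "k \<in> {1, 2, 3}" for j k
    using lim[OF jk, of "inverse \<tau>"] lim[OF jk, of 1] by (simp add: inner_commute divide_inverse)
  then have "lumped_inner M (\<lambda>x. (X x - x) /\<^sub>R \<tau>) g = 1/3 * (\<Sum>j\<in>{1..ntri M}. \<Sum>k\<in>{1, 2, 3}.
      tri_area M j * (vertex_limit M g j k \<bullet> vertex_limit M (\<lambda>x. X x - x) j k) / \<tau>)"
    unfolding lumped_inner_def by (intro arg_cong2[where f = "(*)"] sum.cong refl)
  then show ?thesis
    unfolding lumped_inner_def by (simp only: times_divide_eq_right flip: sum_divide_distrib)
qed

text \<open>The third component vanishes on the boundary curve because both the curve and its image
  lie in the plane.\<close>

lemma fe_vec_space_displacement:
  assumes M: "polygonal_surface M" and X: "X \<in> fe_vec_space M"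
  shows "(\<lambda>x. X x - x) \<in> fe_vec_space M"
proof -
  have sp: "(\<lambda>x. X x $ k - x $ k) \<in> fe_space M" if k: "(\<lambda>x. X x $ k) \<in> fe_space M" for k
    unfolding fe_space_def
  proof (intro CollectI conjI ballI)
    show "continuous_on (surface M) (\<lambda>x. X x $ k - x $ k)"
      using k by (auto simp: fe_space_def intro!: continuous_intros)
    fix j assume "j \<in> {1..ntri M}"
    then obtain a b where "\<And>x. x \<in> tri M j \<Longrightarrow> X x $ k = a \<bullet> x + b"
      using k unfolding fe_space_def by blast
    then have "\<forall>x\<in>tri M j. X x $ k - x $ k = (a - axis k 1) \<bullet> x + b"
      by (simp add: inner_diff_left inner_axis')
    then show "\<exists>a b. \<forall>x\<in>tri M j. X x $ k - x $ k = a \<bullet> x + b" by blast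
  qed
  show ?thesis
    using X M by (simp add: fe_vec_space_def fe_space0_def sp polygonal_surface_def)
qed

section \<open>Energy dissipation\<close>

lemma norm_tri_cross_gamma1:
  "norm (tri_cross M j) * gamma1 A (tri_normal M j) = gamma1 A (tri_cross M j)"
proof (cases "tri_cross M j = 0")
  case False
  then show ?thesis by (simp add: tri_normal_def gamma1_scaleR)
qed (simp add: gamma1_def)

lemma energy_eq_gamma:
  assumes "polygonal_surface M"
  shows "energy L G \<theta> M = (\<Sum>j\<in>{1..ntri M}. gamma L G (tri_normal M j) * tri_area M j)
    - cos \<theta> * enclosed_area M"
  unfolding energy_def
  by (subst surf_integral_piecewise_constant[OF assms, of _ "\<lambda>j. gamma L G (tri_normal M j)"])
     (auto simp: surf_normal_eq[OF assms] tri_area_def sum_divide_distrib mult.commute)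

lemma energy_eq_gamma1:
  assumes "polygonal_surface M"
  shows "energy L G \<theta> M = (\<Sum>i\<in>{1..L}. \<Sum>j\<in>{1..ntri M}. gamma1 (G i) (tri_normal M j) * tri_area M j)
    - cos \<theta> * enclosed_area M"
  unfolding energy_eq_gamma[OF assms] gamma_def sum_distrib_right
  by (subst sum.swap) (rule refl)

text \<open>The assumption on \<open>t\<close> pins it to the basis picked inside
  \<open>aniso_prod\<close>. That choice sees \<open>x\<close> only through the normal, so the
  product is constant on the triangle.\<close>

lemma aniso_prod_displacement:
  assumes M: "polygonal_surface M" and j: "j \<in> {1..ntri M}" and x: "x \<in> tri M j"
    and P: "linear P" and X: "\<And>y. y \<in> tri M j \<Longrightarrow> X y = P y + c"
    and t: "t = (SOME t. is_aniso_basis B (tri_normal M j) t)"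
    and basis: "is_aniso_basis B (tri_normal M j) t"
  shows "aniso_prod M B X (\<lambda>x. X x - x) x = (\<Sum>i\<in>{1, 2}. P (t i) \<bullet> (B *v (P (t i) - t i)))"
proof -
  have orth: "tri_normal M j \<bullet> t i = 0" if "i \<in> {1, 2}" for i
    using basis that span_superset[of "t ` {1, 2}"] unfolding is_aniso_basis_def by blast
  have "linear (\<lambda>y. P y - y)"
    using P by (intro linear_compose_sub linear_ident)
  then have "dir_deriv M (t i) X x = P (t i)" "dir_deriv M (t i) (\<lambda>x. X x - x) x = P (t i) - t i"
    if "i \<in> {1, 2}" for i
    using dir_deriv_affine[OF M j x P _ orth[OF that], of X c]
      dir_deriv_affine[OF M j x _ _ orth[OF that], of "\<lambda>y. P y - y" "\<lambda>y. X y - y" c]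
    by (simp_all add: X)
  then show ?thesis
    unfolding aniso_prod_def surf_normal_eq[OF M j x] t[symmetric] Let_def
    by (intro sum.cong) simp_all
qed

text \<open>Sums \<open>aniso_energy_increment\<close> over the triangles. The factor 1/2 is the
  area of the unit triangle, so the left side is the increment of the surface energy for one
  matrix.\<close>

lemma surf_inner_aniso_prod_ge:
  assumes M: "polygonal_surface M" and X: "X \<in> fe_vec_space M" and A: "sym_pos_def A"
  shows "(\<Sum>j\<in>{1..ntri M}. gamma1 A (tri_cross (image_mesh X M) j) - gamma1 A (tri_cross M j)) / 2
    \<le> surf_inner M (\<lambda>x. gamma1 A (surf_normal M x)) (aniso_prod M (aniso_mat A) X (\<lambda>x. X x - x))"
proof -
  let ?B = "aniso_mat A" and ?n = "tri_normal M"
  define P where "P = (\<lambda>j. SOME P. linear P \<and> (\<exists>c. \<forall>x\<in>convex hull tri_vertices M j. X x = P x + c))"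
  have "linear (P j) \<and> (\<exists>c. \<forall>x\<in>convex hull tri_vertices M j. X x = P j x + c)"
    if "j \<in> {1..ntri M}" for j
  proof -
    have "\<exists>P. linear P \<and> (\<exists>c. \<forall>x\<in>convex hull tri_vertices M j. X x = P x + c)"
      using fe_vec_space_affine[OF X that] by blast
    then show ?thesis
      unfolding P_def by (rule someI_ex)
  qed
  then have P: "linear (P j)"
    and PX: "\<exists>c. \<forall>x\<in>convex hull tri_vertices M j. X x = P j x + c"
    if "j \<in> {1..ntri M}" for j
    using that by blast+
  define t where "t = (\<lambda>j. SOME t. is_aniso_basis ?B (?n j) t)"
  have basis: "is_aniso_basis ?B (?n j) (t j)" if j: "j \<in> {1..ntri M}" for j
  proof -
    have "?n j \<noteq> 0"
      using tri_cross_nonzero[OF M j] by (simp add: tri_normal_def)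
    from aniso_basis_exists[OF A this] show ?thesis
      unfolding t_def by (rule someI_ex)
  qed
  define S where "S = (\<lambda>j. \<Sum>i\<in>{1, 2}. P j (t j i) \<bullet> (?B *v (P j (t j i) - t j i)))"
  have "surf_inner M (\<lambda>x. gamma1 A (surf_normal M x)) (aniso_prod M ?B X (\<lambda>x. X x - x))
    = (\<Sum>j\<in>{1..ntri M}. norm (tri_cross M j) * (gamma1 A (?n j) * S j)) / 2"
    unfolding surf_inner_def
  proof (rule surf_integral_piecewise_constant[OF M])
    fix j x assume j: "j \<in> {1..ntri M}" and x: "x \<in> tri M j"
    obtain c where c: "\<And>y. y \<in> convex hull tri_vertices M j \<Longrightarrow> X y = P j y + c"
      using PX[OF j] by blast
    have "aniso_prod M ?B X (\<lambda>x. X x - x) x = S j"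
      unfolding S_def
    proof (rule aniso_prod_displacement[OF M j x P[OF j]])
      show "X y = P j y + c" if "y \<in> tri M j" for y
        using c that rel_interior_subset unfolding tri_def by blast
    qed (use basis[OF j] in \<open>simp_all add: t_def\<close>)
    then show "gamma1 A (surf_normal M x) \<bullet> aniso_prod M ?B X (\<lambda>x. X x - x) x
      = gamma1 A (?n j) * S j"
      by (simp add: surf_normal_eq[OF M j x])
  qed
  moreover have "gamma1 A (tri_cross (image_mesh X M) j) - gamma1 A (tri_cross M j)
    \<le> norm (tri_cross M j) * (gamma1 A (?n j) * S j)" if j: "j \<in> {1..ntri M}" for j
  proof -
    let ?v = "tri_vertex M j"
    obtain c where c: "\<And>y. y \<in> convex hull tri_vertices M j \<Longrightarrow> X y = P j y + c"
      using PX[OF j] by blast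
    have v: "X (?v k) = P j (?v k) + c" if "k \<in> {1, 2, 3}" for k
      using that by (intro c hull_inc) (auto simp: tri_vertices_def)
    have "tri_cross (image_mesh X M) j = P j (?v 2 - ?v 1) \<times> P j (?v 3 - ?v 1)"
      using v[of 1] v[of 2] v[of 3] P[OF j] by (simp add: tri_cross_def image_mesh_def linear_diff)
    then show ?thesis
      using aniso_energy_increment[OF A P[OF j] _ _ basis[OF j], of "?v 2 - ?v 1" "?v 3 - ?v 1",
          folded tri_cross_def, OF tri_cross_nonzero[OF M j] tri_normal_def]
      unfolding S_def by simp
  qed
  ultimately show ?thesis
    by (simp only: divide_right_mono sum_mono zero_le_numeral)
qed

lemma surf_norm_squared: "(surf_norm M f)\<^sup>2 = surf_inner M f f"
proof -
  have "surf_inner M f f \<ge> 0"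
    unfolding surf_inner_def surf_integral_def set_lebesgue_integral_def
    by (intro sum_nonneg mult_nonneg_nonneg integral_nonneg_AE) (auto intro!: AE_I2 scaleR_nonneg_nonneg)
  then show ?thesis by (simp add: surf_norm_def)
qed

lemma bdry_norm_squared: "(bdry_norm M f)\<^sup>2 = bdry_inner M f f"
proof -
  have "bdry_inner M f f \<ge> 0"
    unfolding bdry_inner_def bdry_integral_def set_lebesgue_integral_def
    by (intro sum_nonneg mult_nonneg_nonneg integral_nonneg_AE)
       (auto intro!: AE_I2 scaleR_nonneg_nonneg simp: seg_length_def)
  then show ?thesis by (simp add: bdry_norm_def)
qed

lemma bdry_inner_scale:
  fixes f g :: "real^3 \<Rightarrow> real"
  shows "bdry_inner M (\<lambda>x. c * f x) (\<lambda>x. c * g x) = c\<^sup>2 * bdry_inner M f g"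
proof -
  have "(c * f x) \<bullet> (c * g x) = c\<^sup>2 * (f x \<bullet> g x)" for x
    by (simp add: power2_eq_square)
  then show ?thesis
    unfolding bdry_inner_def bdry_integral_def sum_distrib_left
    by (simp only: set_integral_mult_right mult.left_commute)
qed

lemma scheme_step_energy:
  assumes "\<tau> > 0" "\<eta> > 0"
    and G: "\<And>i. i \<in> {1..L} \<Longrightarrow> sym_pos_def (G i)"
    and M: "polygonal_surface M" and M': "polygonal_surface (image_mesh X M)"
    and step: "scheme_step \<tau> \<eta> \<theta> L G M X \<mu>"
  shows "\<tau> * ((surf_norm M (surf_grad M \<mu>))\<^sup>2
      + 1 / \<eta> * (bdry_norm M (\<lambda>x. ((X x - x) /\<^sub>R \<tau>) \<bullet> bdry_normal M x))\<^sup>2)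
    \<le> energy L G \<theta> M - energy L G \<theta> (image_mesh X M)"
proof -
  let ?M' = "image_mesh X M" and ?v = "\<lambda>x. X x - x"
  let ?Q = "lumped_inner M (\<lambda>x. \<mu> x *\<^sub>R surf_normal M x) ?v"
  let ?D = "surf_inner M (surf_grad M \<mu>) (surf_grad M \<mu>)"
  let ?vn = "\<lambda>x. ?v x \<bullet> bdry_normal M x"
  let ?S = "\<Sum>i\<in>{1..L}. surf_inner M (\<lambda>x. gamma1 (G i) (surf_normal M x))
    (aniso_prod M (aniso_mat (G i)) X ?v)"
  let ?E = "\<lambda>M. \<Sum>i\<in>{1..L}. \<Sum>j\<in>{1..ntri M}. gamma1 (G i) (tri_normal M j) * tri_area M j"
  have X: "X \<in> fe_vec_space M" and \<mu>: "\<mu> \<in> fe_space M"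
    using step by (simp_all add: scheme_step_def)
  have "lumped_inner M (\<lambda>x. ?v x /\<^sub>R \<tau>) (\<lambda>x. \<mu> x *\<^sub>R surf_normal M x) + ?D = 0"
    using step \<mu> unfolding scheme_step_def by blast
  then have eq1: "?Q = - \<tau> * ?D"
    unfolding lumped_inner_displacement[OF M X] using assms(1) by (simp add: field_simps)
  have "?Q - ?S + cos \<theta> * bdry_inner M (bdry_normal_half M X) ?v
      - 1 / (\<eta> * \<tau>) * bdry_inner M ?vn ?vn = 0"
    using step fe_vec_space_displacement[OF M X] unfolding scheme_step_def by blast
  then have eq2: "\<tau> * ?D + ?S + 1 / (\<eta> * \<tau>) * bdry_inner M ?vn ?vn
      = cos \<theta> * (enclosed_area ?M' - enclosed_area M)"
    by (simp add: eq1 bdry_inner_normal_half[OF X M M'])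
  \<comment> \<open>Stated for every mesh, so that it serves both time levels.\<close>
  have E: "?E M = (\<Sum>i\<in>{1..L}. (\<Sum>j\<in>{1..ntri M}. gamma1 (G i) (tri_cross M j)) / 2)" for M
    unfolding sum_divide_distrib
    by (intro sum.cong refl) (simp add: tri_area_def mult.commute norm_tri_cross_gamma1)
  have "?E ?M' - ?E M = (\<Sum>i\<in>{1..L}.
      (\<Sum>j\<in>{1..ntri M}. gamma1 (G i) (tri_cross ?M' j) - gamma1 (G i) (tri_cross M j)) / 2)"
    unfolding E by (simp add: sum_subtractf diff_divide_distrib image_mesh_def)
  also have "\<dots> \<le> ?S"
    using surf_inner_aniso_prod_ge[OF M X G] by (intro sum_mono)
  finally have "\<tau> * ?D + 1 / (\<eta> * \<tau>) * bdry_inner M ?vn ?vn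
      \<le> energy L G \<theta> M - energy L G \<theta> ?M'"
    using eq2 unfolding energy_eq_gamma1[OF M] energy_eq_gamma1[OF M'] right_diff_distrib
    by linarith
  \<comment> \<open>The scheme carries squared displacements with weight
    \<open>1 / (\<eta> * \<tau>)\<close>, the claim squared velocities; the factor
    \<open>\<tau>\<close> in front absorbs the difference.\<close>
  moreover have "(bdry_norm M (\<lambda>x. (?v x /\<^sub>R \<tau>) \<bullet> bdry_normal M x))\<^sup>2
      = (inverse \<tau>)\<^sup>2 * bdry_inner M ?vn ?vn"
    unfolding bdry_norm_squared inner_scaleR_left by (rule bdry_inner_scale)
  then have "\<tau> * (1 / \<eta> * (bdry_norm M (\<lambda>x. (?v x /\<^sub>R \<tau>) \<bullet> bdry_normal M x))\<^sup>2)
      = 1 / (\<eta> * \<tau>) * bdry_inner M ?vn ?vn"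
    using assms(1,2) by (simp add: field_simps power2_eq_square)
  ultimately show ?thesis
    by (simp only: surf_norm_squared distrib_left)
qed

theorem theorem4p2:
  fixes \<tau> \<eta> \<theta> :: real
    and L :: nat and G :: "nat \<Rightarrow> real^3^3"
    and M :: "nat \<Rightarrow> mesh"
    and X :: "nat \<Rightarrow> real^3 \<Rightarrow> real^3"
    and \<mu> :: "nat \<Rightarrow> real^3 \<Rightarrow> real"
  assumes "\<tau> > 0" and "\<eta> > 0" and "\<theta> \<in> {0..pi}"
    and "\<And>i. i \<in> {1..L} \<Longrightarrow> sym_pos_def (G i)"
    and "\<And>m. polygonal_surface (M m)"
    and "\<And>m. M (Suc m) = image_mesh (X (Suc m)) (M m)"
    and "\<And>m. scheme_step \<tau> \<eta> \<theta> L G (M m) (X (Suc m)) (\<mu> (Suc m))"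
  shows "(\<forall>m. energy L G \<theta> (M m) =
                (\<Sum>j\<in>{1..ntri (M m)}. gamma L G (tri_normal (M m) j) * tri_area (M m) j)
                - cos \<theta> * enclosed_area (M m)) \<and>
         (\<forall>m. energy L G \<theta> (M (Suc m)) \<le> energy L G \<theta> (M m) \<and> energy L G \<theta> (M m) \<le> energy L G \<theta> (M 0)) \<and>
         energy L G \<theta> (M 0) =
                (\<Sum>i\<in>{1..L}. \<Sum>j\<in>{1..ntri (M 0)}.
                   gamma1 (G i) (tri_normal (M 0) j) * tri_area (M 0) j)
                - cos \<theta> * enclosed_area (M 0) \<and>
         (\<forall>m. (\<Sum>l\<in>{1..m+1}. (surf_norm (M (l - 1)) (surf_grad (M (l - 1)) (\<mu> l)))\<^sup>2)
              + 1 / \<eta> * (\<Sum>l\<in>{1..m+1}. (bdry_norm (M (l - 1))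
                    (\<lambda>x. ((X l x - x) /\<^sub>R \<tau>) \<bullet> bdry_normal (M (l - 1)) x))\<^sup>2)
              \<le> (energy L G \<theta> (M 0) - energy L G \<theta> (M (m + 1))) / \<tau>)"
proof -
  let ?E = "\<lambda>m. energy L G \<theta> (M m)"
  let ?d = "\<lambda>l. (surf_norm (M (l - 1)) (surf_grad (M (l - 1)) (\<mu> l)))\<^sup>2"
  let ?b = "\<lambda>l. (bdry_norm (M (l - 1)) (\<lambda>x. ((X l x - x) /\<^sub>R \<tau>) \<bullet> bdry_normal (M (l - 1)) x))\<^sup>2"
  have step: "\<tau> * (?d (Suc m) + 1 / \<eta> * ?b (Suc m)) \<le> ?E m - ?E (Suc m)" for m
    using scheme_step_energy[OF assms(1,2,4,5) _ assms(7), of m] assms(5)[of "Suc m"] assms(6)[of m]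
    by simp
  have decr: "?E (Suc m) \<le> ?E m" for m
  proof -
    have "0 \<le> \<tau> * (?d (Suc m) + 1 / \<eta> * ?b (Suc m))"
      using assms(1,2) by (intro mult_nonneg_nonneg add_nonneg_nonneg) auto
    then show ?thesis using step[of m] by linarith
  qed
  have decr0: "?E m \<le> ?E 0" for m
    using lift_Suc_antimono_le[of ?E 0 m] decr by simp
  \<comment> \<open>The energy drops of the single steps telescope.\<close>
  have sum: "\<tau> * (\<Sum>l\<in>{1..m}. ?d l + 1 / \<eta> * ?b l) \<le> ?E 0 - ?E m" for m
  proof (induction m)
    case (Suc m)
    have "\<tau> * (\<Sum>l\<in>{1..Suc m}. ?d l + 1 / \<eta> * ?b l)
      = \<tau> * (\<Sum>l\<in>{1..m}. ?d l + 1 / \<eta> * ?b l) + \<tau> * (?d (Suc m) + 1 / \<eta> * ?b (Suc m))"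
      by (simp add: distrib_left)
    then show ?case using Suc.IH step[of m] by linarith
  qed simp
  have bound: "(\<Sum>l\<in>{1..m+1}. ?d l) + 1 / \<eta> * (\<Sum>l\<in>{1..m+1}. ?b l) \<le> (?E 0 - ?E (m + 1)) / \<tau>" for m
    using sum[of "m + 1"] assms(1)
    by (simp only: pos_le_divide_eq sum.distrib sum_distrib_left mult.commute[of _ \<tau>])
  show ?thesis
    using energy_eq_gamma[OF assms(5)] energy_eq_gamma1[OF assms(5)] decr decr0 bound
    by (intro conjI allI) blast+
qed

end
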